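(* Let $k,d,t\in\mathbb{N}$ with $t\geq k$. If a finite graph $G$ has a $(k,d)$-partition, then $G$ is equitably $(t,\mathcal{D}_{d-1})$-choosable. Moreover, there is an algorithm which, given a graph $G$ together with a $(k,d)$-partition of $G$ and a $t$-uniform list assignment $L$ for $G$, returns an equitable $(L,\mathcal{D}_{d-1})$-colouring of $G$ in time polynomial in $|V(G)|$.
   Context: $\mathbb{N}=\{1,2,\dots\}$, $\mathbb{N}_0=\mathbb{N}\cup\{0\}$. For $d\in\mathbb{N}_0$, a graph $G$ is $d$-degenerate if every subgraph $H$ of $G$ has minimum degree $\delta(H)\le d$; $\mathcal{D}_d$ is the class of $d$-degenerate graphs (so $\mathcal{D}_0$ = edgeless graphs, $\mathcal{D}_1$ = forests). A list assignment $L$ for $G$ assigns a nonempty subset $L(v)\subseteq\mathbb{N}$ to each vertex $v$; it is $k$-uniform if $|L(v)|=k$ for all $v$. An $(L,\mathcal{D}_d)$-colouring of $G$ is a map $c:V(G)\to\mathbb{N}$ with $c(v)\in L(v)$ for all $v$ such that for every $i$ the set of vertices coloured $i$ induces a $d$-degenerate graph. For a $t$-uniform $L$, an equitable $(L,\mathcal{D}_d)$-colouring is an $(L,\mathcal{D}_d)$-colouring in which every colour class has at most $\lceil |V(G)|/t\rceil$ vertices. $G$ is equitably $(t,\mathcal{D}_d)$-choosable if for every $t$-uniform list assignment $L$ for $G$ there is an equitable $(L,\mathcal{D}_d)$-colouring of $G$. For $k,d\in\mathbb{N}$, a $(k,d)$-partition of $G$ is a partition $S_1\cup\cdots\cup S_{\eta+1}$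 of $V(G)$ such that $|S_1|\le k$, $|S_j|=k$ for $j\in\{2,\dots,\eta+1\}$, and for each $j\in\{2,\dots,\eta+1\}$ there is an ordering $x_1^j,\dots,x_k^j$ of $S_j$ with $|N_G(x_i^j)\cap(S_1\cup\cdots\cup S_{j-1})|\le di-1$ for every $i\in\{1,\dots,k\}$, where $N_G(v)$ is the set of neighbours of $v$ in $G$. *)

theory Defs
  imports
    Complex_Main
    "HOL-Library.Disjoint_Sets"
    "HOL-Computational_Algebra.Polynomial"
begin

section \<open>Graphs and degeneracy\<close>

definition finite_graph :: "'a set \<Rightarrow> 'a set set \<Rightarrow> bool" where
  "finite_graph V E \<longleftrightarrow> finite V \<and> E \<subseteq> {e. e \<subseteq> V \<and> card e = 2}"

definition neighbours :: "'a set set \<Rightarrow> 'a \<Rightarrow> 'a set" where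
  "neighbours E v = {u. {u, v} \<in> E \<and> u \<noteq> v}"

definition min_degree :: "'a set \<Rightarrow> 'a set set \<Rightarrow> nat" where
  "min_degree V E = Min ((\<lambda>v. card (neighbours E v)) ` V)"

definition subgraph :: "'a set \<Rightarrow> 'a set set \<Rightarrow> 'a set \<Rightarrow> 'a set set \<Rightarrow> bool" where
  "subgraph W F V E \<longleftrightarrow> finite_graph W F \<and> W \<subseteq> V \<and> F \<subseteq> E"

text \<open>Only nonempty subgraphs have a minimum degree; in particular the empty graph is
  degenerate for every bound.\<close>

definition degenerate :: "nat \<Rightarrow> 'a set \<Rightarrow> 'a set set \<Rightarrow> bool" where
  "degenerate d V E \<longleftrightarrow>
     (\<forall>W F. subgraph W F V E \<and> W \<noteq> {} \<longrightarrow> min_degree W F \<le> d)"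

definition induced_edges :: "'a set set \<Rightarrow> 'a set \<Rightarrow> 'a set set" where
  "induced_edges E W = {e \<in> E. e \<subseteq> W}"


section \<open>List colourings into degenerate classes\<close>

definition list_assignment :: "'a set \<Rightarrow> ('a \<Rightarrow> nat set) \<Rightarrow> bool" where
  "list_assignment V L \<longleftrightarrow> (\<forall>v\<in>V. L v \<noteq> {} \<and> L v \<subseteq> {1..})"

text \<open>For positive \<open>t\<close>, the cardinality condition also makes the lists finite.\<close>

definition uniform_lists :: "nat \<Rightarrow> 'a set \<Rightarrow> ('a \<Rightarrow> nat set) \<Rightarrow> bool" where
  "uniform_lists t V L \<longleftrightarrow> (\<forall>v\<in>V. card (L v) = t)"

definition colour_class :: "'a set \<Rightarrow> ('a \<Rightarrow> nat) \<Rightarrow> nat \<Rightarrow> 'a set" where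
  "colour_class V c i = {v \<in> V. c v = i}"

definition list_colouring ::
  "nat \<Rightarrow> 'a set \<Rightarrow> 'a set set \<Rightarrow> ('a \<Rightarrow> nat set) \<Rightarrow> ('a \<Rightarrow> nat) \<Rightarrow> bool" where
  "list_colouring d V E L c \<longleftrightarrow>
     (\<forall>v\<in>V. c v \<in> L v) \<and>
     (\<forall>i. degenerate d (colour_class V c i) (induced_edges E (colour_class V c i)))"

definition equitable_list_colouring ::
  "nat \<Rightarrow> nat \<Rightarrow> 'a set \<Rightarrow> 'a set set \<Rightarrow> ('a \<Rightarrow> nat set) \<Rightarrow> ('a \<Rightarrow> nat) \<Rightarrow> bool" where
  "equitable_list_colouring t d V E L c \<longleftrightarrow>
     list_colouring d V E L c \<and>
     (\<forall>i. int (card (colour_class V c i)) \<le> \<lceil>real (card V) / real t\<rceil>)"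

definition equitably_choosable :: "nat \<Rightarrow> nat \<Rightarrow> 'a set \<Rightarrow> 'a set set \<Rightarrow> bool" where
  "equitably_choosable t d V E \<longleftrightarrow>
     (\<forall>L. list_assignment V L \<and> uniform_lists t V L \<longrightarrow>
        (\<exists>c. equitable_list_colouring t d V E L c))"

text \<open>The partition is \<open>S 1, \<dots>, S (\<eta> + 1)\<close>. Since \<open>d\<close> and \<open>i\<close> are positive wherever this
  is used, the subtraction below does not truncate.\<close>

definition kd_partition ::
  "nat \<Rightarrow> nat \<Rightarrow> 'a set \<Rightarrow> 'a set set \<Rightarrow> nat \<Rightarrow> (nat \<Rightarrow> 'a set) \<Rightarrow> bool" where
  "kd_partition k d V E \<eta> S \<longleftrightarrow>
     (\<Union>j\<in>{1..\<eta> + 1}. S j) = V \<and> disjoint_family_on S {1..\<eta> + 1} \<and>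
     card (S 1) \<le> k \<and>
     (\<forall>j\<in>{2..\<eta> + 1}. card (S j) = k \<and>
        (\<exists>x. bij_betw x {1..k} (S j) \<and>
           (\<forall>i\<in>{1..k}. card (neighbours E (x i) \<inter> (\<Union>l\<in>{1..j - 1}. S l)) \<le> d * i - 1)))"


section \<open>Algorithms and their running time\<close>

text \<open>The model of computation is a unit-cost random access machine with structured control
  flow. The memory consists of named arrays of natural numbers, indexed by natural numbers; a
  program mentions finitely many names, and a scalar variable is an array used at index 0 only.
  The arithmetic operations are addition and truncated subtraction. There is deliberately no
  multiplication, since at unit cost it would allow numbers of exponential length to be produced
  in polynomial time. With addition and subtraction alone, each step lengthens the largest
  number by at most one bit, so polynomial time here agrees with the usual notion.\<close>

type_synonym state = "string \<Rightarrow> nat \<Rightarrow> nat"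

datatype aexp = Num nat | Arr string aexp | Plus aexp aexp | Minus aexp aexp

primrec aval :: "aexp \<Rightarrow> state \<Rightarrow> nat" where
  "aval (Num m) s = m"
| "aval (Arr x a) s = s x (aval a s)"
| "aval (Plus a b) s = aval a s + aval b s"
| "aval (Minus a b) s = aval a s - aval b s"

primrec acost :: "aexp \<Rightarrow> nat" where
  "acost (Num m) = 1"
| "acost (Arr x a) = acost a + 1"
| "acost (Plus a b) = acost a + acost b + 1"
| "acost (Minus a b) = acost a + acost b + 1"

text \<open>\<open>Assign x a b\<close> stores the value of \<open>b\<close> at index \<open>a\<close> of the array \<open>x\<close>; a test succeeds
  iff its value is nonzero.\<close>

datatype com =
    Skip
  | Assign string aexp aexp
  | Seq com com
  | Cond aexp com com
  | While aexp com

text \<open>\<open>exec p s T s'\<close>: started in state \<open>s\<close>, the program \<open>p\<close> terminates in state \<open>s'\<close> after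
  exactly \<open>T\<close> elementary steps.\<close>

inductive exec :: "com \<Rightarrow> state \<Rightarrow> nat \<Rightarrow> state \<Rightarrow> bool" where
  Skip: "exec Skip s 1 s"
| Assign: "exec (Assign x a b) s (acost a + acost b + 1)
             (s(x := (s x)(aval a s := aval b s)))"
| Seq: "exec p s T1 s1 \<Longrightarrow> exec q s1 T2 s2 \<Longrightarrow> exec (Seq p q) s (T1 + T2) s2"
| CondTrue: "aval a s \<noteq> 0 \<Longrightarrow> exec p s T s1 \<Longrightarrow> exec (Cond a p q) s (acost a + 1 + T) s1"
| CondFalse: "aval a s = 0 \<Longrightarrow> exec q s T s1 \<Longrightarrow> exec (Cond a p q) s (acost a + 1 + T) s1"
| WhileFalse: "aval a s = 0 \<Longrightarrow> exec (While a p) s (acost a + 1) s"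
| WhileTrue: "aval a s \<noteq> 0 \<Longrightarrow> exec p s T1 s1 \<Longrightarrow> exec (While a p) s1 T2 s2 \<Longrightarrow>
    exec (While a p) s (acost a + 1 + T1 + T2) s2"

inductive_cases exec_SkipE: "exec Skip s T s'"
inductive_cases exec_AssignE: "exec (Assign x a b) s T s'"
inductive_cases exec_SeqE: "exec (Seq p q) s T s'"
inductive_cases exec_CondE: "exec (Cond a p q) s T s'"
inductive_cases exec_WhileE: "exec (While a p) s T s'"

lemma exec_deterministic:
  "exec p s T s' \<Longrightarrow> exec p s T' s'' \<Longrightarrow> T = T' \<and> s' = s''"
proof (induction arbitrary: T' s'' rule: exec.induct)
  case (Skip s)
  then show ?case by (rule exec_SkipE) simp
next
  case (Assign x a b s)
  then show ?case by (rule exec_AssignE) simp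
next
  case (Seq p s T1 s1 q T2 s2)
  from Seq.prems obtain U1 r U2
    where *: "T' = U1 + U2" "exec p s U1 r" "exec q r U2 s''"
    by (rule exec_SeqE)
  from Seq.IH(1)[OF *(2)] have 1: "T1 = U1" "s1 = r" by simp_all
  from Seq.IH(2)[unfolded 1, OF *(3)] 1 *(1) show ?case by simp
next
  case (CondTrue a s p T s1 q)
  from CondTrue.prems obtain U
    where *: "T' = acost a + 1 + U" "exec p s U s''"
    by (rule exec_CondE) (use CondTrue.hyps(1) in simp_all)
  from CondTrue.IH[OF *(2)] *(1) show ?case by simp
next
  case (CondFalse a s q T s1 p)
  from CondFalse.prems obtain U
    where *: "T' = acost a + 1 + U" "exec q s U s''"
    by (rule exec_CondE) (use CondFalse.hyps(1) in simp_all)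
  from CondFalse.IH[OF *(2)] *(1) show ?case by simp
next
  case (WhileFalse a s p)
  from WhileFalse.prems show ?case
    by (rule exec_WhileE) (use WhileFalse.hyps in simp_all)
next
  case (WhileTrue a s p T1 s1 T2 s2)
  from WhileTrue.prems obtain U1 r U2
    where *: "T' = acost a + 1 + U1 + U2" "exec p s U1 r" "exec (While a p) r U2 s''"
    by (rule exec_WhileE) (use WhileTrue.hyps(1) in simp_all)
  from WhileTrue.IH(1)[OF *(2)] have 1: "T1 = U1" "s1 = r" by simp_all
  from WhileTrue.IH(2)[unfolded 1, OF *(3)] 1 *(1) show ?case by simp
qed

text \<open>A memory state presenting a problem instance on the vertex set \<open>{..<n}\<close>: the number of
  vertices, the adjacency matrix in row-major order, for each vertex the index of its part, and
  for each vertex the \<open>t\<close> colours of its list in arbitrary order. Only the parts themselves are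
  given, not the orderings whose existence is required by \<^const>\<open>kd_partition\<close>. All other
  arrays are initially zero.\<close>

definition input_state ::
  "nat \<Rightarrow> nat \<Rightarrow> nat set set \<Rightarrow> nat \<Rightarrow> (nat \<Rightarrow> nat set) \<Rightarrow> (nat \<Rightarrow> nat set) \<Rightarrow> state \<Rightarrow> bool" where
  "input_state t n E \<eta> S L s \<longleftrightarrow>
     s ''n'' 0 = n \<and>
     (\<forall>u<n. \<forall>v<n. s ''adj'' (n * u + v) = (if {u, v} \<in> E then 1 else 0)) \<and>
     (\<forall>v<n. s ''part'' v \<in> {1..\<eta> + 1} \<and> v \<in> S (s ''part'' v)) \<and>
     (\<forall>v<n. bij_betw (\<lambda>i. s ''list'' (t * v + i)) {..<t} (L v)) \<and>
     (\<forall>x. x \<notin> {''n'', ''adj'', ''part'', ''list''} \<longrightarrow> s x = (\<lambda>_. 0))"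

text \<open>The colour computed for vertex \<open>v\<close> is read off from index \<open>v\<close> of the array \<open>''col''\<close>. The
  running time is bounded by a polynomial in the number of vertices alone.\<close>

definition poly_time_equitable_colouring :: "nat \<Rightarrow> nat \<Rightarrow> nat \<Rightarrow> com \<Rightarrow> bool" where
  "poly_time_equitable_colouring k d t p \<longleftrightarrow>
     (\<exists>Q :: nat poly. \<forall>n E \<eta> S L s.
        finite_graph {..<n} E \<and> kd_partition k d {..<n} E \<eta> S \<and>
        list_assignment {..<n} L \<and> uniform_lists t {..<n} L \<and>
        input_state t n E \<eta> S L s \<longrightarrow>
        (\<exists>T s'. exec p s T s' \<and> T \<le> poly Q n \<and>
           equitable_list_colouring t (d - 1) {..<n} E L (s' ''col'')))"

end

theory Submission
  imports Defs
begin

text \<open>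
  The parts are coloured one after the other, and the vertices of a part in order of decreasing
  number of neighbours in earlier parts. All vertices of a part get different colours, and the
  coloured vertices are moreover distributed over blocks with pairwise different colours, where
  all blocks except the last have size \<open>t\<close>; this bounds the colour classes by
  \<open>\<lceil>|V| / t\<rceil>\<close>. Suppose that the current block has room for \<open>s\<close> more vertices and that \<open>i\<close>
  vertices of the part, including the next vertex \<open>v\<close>, are uncoloured. Fewer than \<open>i\<close> colours
  occur on at least \<open>d\<close> earlier neighbours of \<open>v\<close>. If \<open>s \<ge> i\<close>, the colour of \<open>v\<close> also avoids
  the \<open>t - s\<close> colours of the block; if \<open>s < i\<close>, it only has to avoid the at most \<open>k - i\<close> colours
  of its part. Either way fewer than \<open>t\<close> colours are excluded. The vertex \<open>v\<close> joins the current
  block if the block is not full and does not contain its colour, and the next block otherwise.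
  A vertex sent to the next block while the current one has room thus repeats a colour of the
  current block, so that avoiding the colours of the block includes avoiding those of the part.
  As soon as \<open>s = i\<close>, all remaining vertices of the part join the current block and fill it.
\<close>

section \<open>The greedy colouring\<close>

definition back_degree :: "'a set \<Rightarrow> 'a set set \<Rightarrow> ('a \<Rightarrow> nat) \<Rightarrow> 'a \<Rightarrow> nat" where
  "back_degree V E P v = card (neighbours E v \<inter> {u \<in> V. P u < P v})"

text \<open>\<open>P\<close> gives the index of the part of each vertex. The orderings of a
  (k,d)-partition are replaced by the counting condition \<open>high_back_degree\<close>: they imply
  it, and the greedy procedure can work with it while knowing only the parts. Empty parts are
  allowed in \<open>part_eq\<close> so that \<open>j\<close> may range over all natural numbers;
  apart from these, only part 1 may have fewer than \<open>k\<close> vertices.\<close>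

locale list_instance =
  fixes V :: "'a set" and E :: "'a set set" and P :: "'a \<Rightarrow> nat" and L :: "'a \<Rightarrow> nat set"
    and k d t :: nat
  assumes finV: "finite V" and k_pos: "1 \<le> k" and d_pos: "1 \<le> d" and k_le_t: "k \<le> t"
    and P_pos: "v \<in> V \<Longrightarrow> 1 \<le> P v"
    and L_card: "v \<in> V \<Longrightarrow> card (L v) = t"
    and L_pos: "v \<in> V \<Longrightarrow> 0 \<notin> L v"
    and part_le: "card {v \<in> V. P v = j} \<le> k"
    and part_eq: "j \<noteq> 1 \<Longrightarrow> {v \<in> V. P v = j} = {} \<or> card {v \<in> V. P v = j} = k"
    and high_back_degree: "1 \<le> i \<Longrightarrow> i \<le> k \<Longrightarrow>
      card {v \<in> V. P v = j \<and> d * i \<le> back_degree V E P v} \<le> k - i"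
begin

definition coloured_neighbours :: "('a \<Rightarrow> nat) \<Rightarrow> 'a \<Rightarrow> nat \<Rightarrow> 'a set" where
  "coloured_neighbours col v c = {w \<in> V. w \<in> neighbours E v \<and> col w = c}"

definition block :: "('a \<Rightarrow> nat) \<Rightarrow> nat \<Rightarrow> 'a set" where
  "block blk b = {w \<in> V. blk w = b}"

definition free :: "('a \<Rightarrow> nat) \<Rightarrow> nat \<Rightarrow> nat" where
  "free blk b = t - card (block blk b)"

definition coloured_part :: "nat \<Rightarrow> 'a set \<Rightarrow> 'a set" where
  "coloured_part j C = {w \<in> C. P w = j}"

text \<open>In a part with fewer than \<open>k\<close> vertices this exceeds the number of
  uncoloured vertices.\<close>

definition todo :: "nat \<Rightarrow> 'a set \<Rightarrow> nat" where
  "todo j C = k - card (coloured_part j C)"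

text \<open>The combinatorial core of the degeneracy of all colour classes within \<open>C\<close>.\<close>

definition thin :: "'a set \<Rightarrow> ('a \<Rightarrow> nat) \<Rightarrow> bool" where
  "thin C col \<longleftrightarrow> (\<forall>W\<subseteq>C. W \<noteq> {} \<and> (\<forall>u\<in>W. \<forall>v\<in>W. col u = col v) \<longrightarrow>
     (\<exists>v\<in>W. card (neighbours E v \<inter> W) < d))"

text \<open>Block 0 and colour 0 mark the uncoloured vertices, which fits arrays that are initially
  zero; no list contains 0. The injectivity condition is what bounds the colour classes: a colour
  occurs at most once in each block.\<close>

definition base :: "'a set \<Rightarrow> ('a \<Rightarrow> nat) \<Rightarrow> ('a \<Rightarrow> nat) \<Rightarrow> nat \<Rightarrow> bool" where
  "base C col blk b \<longleftrightarrow> C \<subseteq> V \<and> 1 \<le> b \<and>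
     (\<forall>w\<in>C. col w \<in> L w \<and> 1 \<le> blk w) \<and> (\<forall>w\<in>V - C. blk w = 0 \<and> col w = 0) \<and>
     inj_on (\<lambda>w. (blk w, col w)) C \<and>
     (\<forall>b'. 1 \<le> b' \<and> b' < b \<longrightarrow> card (block blk b') = t) \<and> card (block blk b) \<le> t \<and>
     thin C col"

text \<open>Part \<open>j\<close> is being coloured and \<open>b\<close> is the current block. The last disjunction says that
  either everything so far went to the current block, which has room for the rest of the part, or
  the current block will be filled before the part ends.\<close>

definition part_inv :: "nat \<Rightarrow> 'a set \<Rightarrow> ('a \<Rightarrow> nat) \<Rightarrow> ('a \<Rightarrow> nat) \<Rightarrow> nat \<Rightarrow> bool" where
  "part_inv j C col blk b \<longleftrightarrow> base C col blk b \<and>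
     (\<forall>w\<in>C. P w \<le> j) \<and> (\<forall>w\<in>V. P w < j \<longrightarrow> w \<in> C) \<and>
     (\<forall>w\<in>C. blk w \<le> b + 1 \<and> (blk w = b + 1 \<longrightarrow> P w = j)) \<and>
     inj_on col (coloured_part j C) \<and>
     (free blk b = 0 \<or> col ` coloured_part j C \<subseteq> col ` block blk b) \<and>
     (block blk (b + 1) = {} \<and> todo j C \<le> free blk b \<or>
      free blk b \<le> todo j C \<and> (coloured_part j V = {} \<or> card (coloured_part j V) = k))"

definition avoided :: "nat \<Rightarrow> 'a set \<Rightarrow> ('a \<Rightarrow> nat) \<Rightarrow> ('a \<Rightarrow> nat) \<Rightarrow> nat \<Rightarrow> nat set" where
  "avoided j C col blk b = col ` (if todo j C \<le> free blk b then block blk b else coloured_part j C)"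

definition admissible ::
    "nat \<Rightarrow> 'a set \<Rightarrow> ('a \<Rightarrow> nat) \<Rightarrow> ('a \<Rightarrow> nat) \<Rightarrow> nat \<Rightarrow> 'a \<Rightarrow> nat \<Rightarrow> bool" where
  "admissible j C col blk b v c \<longleftrightarrow>
     c \<in> L v \<and> c \<notin> avoided j C col blk b \<and> card (coloured_neighbours col v c) < d"

definition next_block :: "('a \<Rightarrow> nat) \<Rightarrow> ('a \<Rightarrow> nat) \<Rightarrow> nat \<Rightarrow> nat \<Rightarrow> nat" where
  "next_block col blk b c = (if free blk b = 0 \<or> c \<in> col ` block blk b then b + 1 else b)"

section \<open>Preservation of the invariants and the finished colouring\<close>

lemma finite_parts[simp]: "finite (block blk b)" "finite (coloured_neighbours col v c)"
  "C \<subseteq> V \<Longrightarrow> finite (coloured_part j C)"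
  using finV by (auto simp: block_def coloured_neighbours_def coloured_part_def intro: finite_subset)

lemma L_finite: "v \<in> V \<Longrightarrow> finite (L v)"
  using L_card k_pos k_le_t by (metis card.infinite le_trans not_one_le_zero)

lemma card_coloured_part_mono: "C \<subseteq> V \<Longrightarrow> card (coloured_part j C) \<le> card (coloured_part j V)"
  by (rule card_mono) (auto simp: coloured_part_def finV)

lemma card_coloured_part_le: "card (coloured_part j V) \<le> k"
  using part_le by (simp add: coloured_part_def)

lemma baseD:
  assumes "base C col blk b"
  shows "C \<subseteq> V" "1 \<le> b" "\<forall>w\<in>C. col w \<in> L w" "\<forall>w\<in>C. 1 \<le> blk w"
    "\<forall>w\<in>V - C. blk w = 0" "\<forall>w\<in>V - C. col w = 0" "inj_on (\<lambda>w. (blk w, col w)) C"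
    "\<forall>b'. 1 \<le> b' \<and> b' < b \<longrightarrow> card (block blk b') = t" "card (block blk b) \<le> t"
    "thin C col"
  using assms unfolding base_def by simp_all

lemma part_invD:
  assumes "part_inv j C col blk b"
  shows "base C col blk b" "C \<subseteq> V" "\<forall>w\<in>C. P w \<le> j" "\<forall>w\<in>V. P w < j \<longrightarrow> w \<in> C"
    "\<forall>w\<in>C. blk w \<le> b + 1" "\<forall>w\<in>C. blk w = b + 1 \<longrightarrow> P w = j" "inj_on col (coloured_part j C)"
    "free blk b = 0 \<or> col ` coloured_part j C \<subseteq> col ` block blk b"
    "block blk (b + 1) = {} \<and> todo j C \<le> free blk b \<or>
      free blk b \<le> todo j C \<and> (coloured_part j V = {} \<or> card (coloured_part j V) = k)"
  using assms baseD(1)[of C col blk b] unfolding part_inv_def by simp_all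

lemma block_subset:
  assumes "base C col blk b" "1 \<le> b'"
  shows "block blk b' \<subseteq> C"
proof
  fix w assume "w \<in> block blk b'"
  then have w: "w \<in> V" "blk w \<noteq> 0" using assms(2) by (auto simp: block_def)
  have "\<forall>w\<in>V - C. blk w = 0" using baseD(5)[OF assms(1)] .
  with w show "w \<in> C" by (metis DiffI)
qed

lemma back_degree_less_todo:
  assumes C: "C \<subseteq> V" and v: "v \<in> V - C" "P v = j"
    and max: "\<And>w. w \<in> coloured_part j C \<Longrightarrow> back_degree V E P v \<le> back_degree V E P w"
  shows "1 \<le> todo j C" "back_degree V E P v < d * todo j C"
proof -
  have ins: "insert v (coloured_part j C) \<subseteq> coloured_part j V" "v \<notin> coloured_part j C"
    using C v by (auto simp: coloured_part_def)
  have fin: "finite (coloured_part j C)" using C by simp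
  have "card (insert v (coloured_part j C)) \<le> card (coloured_part j V)"
    by (rule card_mono) (use ins in auto)
  then have c: "card (coloured_part j C) + 1 \<le> k"
    using ins fin card_coloured_part_le[of j] by simp
  then show t: "1 \<le> todo j C" by (simp add: todo_def)
  show "back_degree V E P v < d * todo j C"
  proof (rule ccontr)
    assume "\<not> ?thesis"
    then have "insert v (coloured_part j C) \<subseteq> {w \<in> V. P w = j \<and> d * todo j C \<le> back_degree V E P w}"
      using ins max v by (force simp: coloured_part_def)
    then have "card (insert v (coloured_part j C)) \<le>
        card {w \<in> V. P w = j \<and> d * todo j C \<le> back_degree V E P w}"
      by (rule card_mono[rotated]) (simp add: finV)
    also have "\<dots> \<le> k - todo j C"
      using high_back_degree[of "todo j C" j] t by (simp add: todo_def)
    finally have "card (insert v (coloured_part j C)) \<le> k - todo j C" .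
    then show False using ins fin c by (simp add: todo_def)
  qed
qed

text \<open>A monochromatic set containing \<open>v\<close> meets the neighbourhood of
  \<open>v\<close> only in neighbours of colour \<open>c\<close>, of which there are fewer than
  \<open>d\<close>. A set without \<open>v\<close> is handled by the old colouring.\<close>

lemma thin_insert:
  assumes "thin C col" "v \<notin> C" "C \<subseteq> V" "card (coloured_neighbours col v c) < d"
  shows "thin (insert v C) (col(v := c))"
  unfolding thin_def
proof (intro allI impI, elim conjE)
  fix W assume W: "W \<subseteq> insert v C" "W \<noteq> {}"
    and mono: "\<forall>u\<in>W. \<forall>w\<in>W. (col(v := c)) u = (col(v := c)) w"
  show "\<exists>v\<in>W. card (neighbours E v \<inter> W) < d"
  proof (cases "v \<in> W")
    case True
    have "neighbours E v \<inter> W \<subseteq> coloured_neighbours col v c"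
    proof
      fix w assume w: "w \<in> neighbours E v \<inter> W"
      then have "w \<noteq> v" by (auto simp: neighbours_def)
      moreover have "(col(v := c)) w = (col(v := c)) v" using mono True w by blast
      ultimately show "w \<in> coloured_neighbours col v c"
        using w W assms(3) by (auto simp: coloured_neighbours_def)
    qed
    then have "card (neighbours E v \<inter> W) \<le> card (coloured_neighbours col v c)"
      by (intro card_mono) simp_all
    then show ?thesis using True assms(4) by (meson le_less_trans)
  next
    case False
    then have "W \<subseteq> C" using W by blast
    moreover have "\<forall>u\<in>W. \<forall>w\<in>W. col u = col w"
      using mono False by (metis fun_upd_other)
    ultimately show ?thesis using assms(1) W(2) unfolding thin_def by blast
  qed
qed

text \<open>If the colours of the block are avoided, the block still has room, and the invariant
  places the colours of the part among those of the block.\<close>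

lemma coloured_part_colours_avoided:
  assumes "part_inv j C col blk b" "1 \<le> todo j C"
  shows "col ` coloured_part j C \<subseteq> avoided j C col blk b"
  using assms unfolding part_inv_def avoided_def by auto

lemma admissible_exists:
  assumes inv: "part_inv j C col blk b" and v: "v \<in> V - C" "P v = j"
    and max: "\<And>w. w \<in> coloured_part j C \<Longrightarrow> back_degree V E P v \<le> back_degree V E P w"
  shows "\<exists>c. admissible j C col blk b v c"
proof -
  from inv have base: "base C col blk b" and C: "C \<subseteq> V"
    and lt: "\<forall>w\<in>C. P w \<le> j"
    by (simp_all add: part_invD)
  note todo = back_degree_less_todo[OF C v max]
  define A where "A = avoided j C col blk b"
  define N where "N = neighbours E v \<inter> {u \<in> V. P u < P v}"
  define X where "X = {c \<in> L v. d \<le> card {w \<in> N. col w = c}}"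
  have finL: "finite (L v)" and cL: "card (L v) = t" using v L_finite L_card by auto
  have finN: "finite N" unfolding N_def using finV by simp
  have finX: "finite X" using finL by (simp add: X_def)
  have "d * card X = (\<Sum>c\<in>X. d)" by simp
  also have "\<dots> \<le> (\<Sum>c\<in>X. card {w \<in> N. col w = c})" by (rule sum_mono) (simp add: X_def)
  also have "\<dots> = card (\<Union>c\<in>X. {w \<in> N. col w = c})"
    by (rule card_UN_disjoint[symmetric]) (use finX finN in auto)
  also have "\<dots> \<le> card N" by (rule card_mono) (use finN in auto)
  also have "\<dots> < d * todo j C" using todo(2) by (simp add: N_def back_degree_def)
  finally have cX: "card X < todo j C" by simp
  have "finite A" unfolding A_def avoided_def using C by simp
  have cA: "card A \<le> t - todo j C"
  proof (cases "todo j C \<le> free blk b")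
    case True
    then have "card A \<le> card (block blk b)" by (simp add: A_def avoided_def card_image_le)
    moreover have "card (block blk b) \<le> t" using baseD(9)[OF base] .
    ultimately show ?thesis using True by (simp add: free_def)
  next
    case False
    then have "card A \<le> card (coloured_part j C)" using C by (simp add: A_def avoided_def card_image_le)
    then show ?thesis using card_coloured_part_mono[OF C, of j] card_coloured_part_le[of j] k_le_t by (simp add: todo_def)
  qed
  have "card (A \<union> X) \<le> card A + card X" by (rule card_Un_le)
  also have "\<dots> < t" using cA cX k_le_t by (simp add: todo_def)
  finally have "\<not> L v \<subseteq> A \<union> X"
    using cL card_mono[of "A \<union> X" "L v"] \<open>finite A\<close> finX by auto
  then obtain c where c: "c \<in> L v" "c \<notin> A" "c \<notin> X" by blast
  \<comment> \<open>Every neighbour of colour \<open>c\<close> lies in an earlier part: uncoloured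
    vertices have colour 0, which is in no list, and \<open>c\<close> avoids the colours of the
    present part.\<close>
  have "coloured_neighbours col v c \<subseteq> {w \<in> N. col w = c}"
  proof
    fix w assume w: "w \<in> coloured_neighbours col v c"
    have "c \<noteq> 0" using c(1) L_pos[of v] v(1) by (metis DiffD1)
    moreover have "\<forall>w\<in>V - C. col w = 0" using baseD(6)[OF base] .
    moreover have "w \<in> V" "col w = c" using w by (simp_all add: coloured_neighbours_def)
    ultimately have wC: "w \<in> C" by (metis DiffI)
    moreover have "P w \<noteq> j"
      using coloured_part_colours_avoided[OF inv todo(1)] c(2) w wC
      by (auto simp: A_def coloured_part_def coloured_neighbours_def)
    ultimately show "w \<in> {w \<in> N. col w = c}"
      using lt w v by (auto simp: N_def coloured_neighbours_def le_less)
  qed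
  then have "card (coloured_neighbours col v c) \<le> card {w \<in> N. col w = c}"
    by (rule card_mono[rotated]) (simp add: finN)
  then show ?thesis using c unfolding admissible_def A_def X_def by auto
qed

lemma part_inv_step:
  assumes inv: "part_inv j C col blk b" and v: "v \<in> V - C" "P v = j"
    and max: "\<And>w. w \<in> coloured_part j C \<Longrightarrow> back_degree V E P v \<le> back_degree V E P w"
    and adm: "admissible j C col blk b v c"
  shows "part_inv j (insert v C) (col(v := c)) (blk(v := next_block col blk b c)) b"
proof -
  let ?B = "next_block col blk b c"
  let ?col = "col(v := c)" and ?blk = "blk(v := ?B)" and ?C = "insert v C"
  note base = part_invD(1)[OF inv] and C = part_invD(2)[OF inv] and lt = part_invD(3)[OF inv]
    and ge = part_invD(4)[OF inv] and blk = part_invD(5,6)[OF inv] and inj = part_invD(7)[OF inv]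
    and cov = part_invD(8)[OF inv] and slots = part_invD(9)[OF inv]
  note todo = back_degree_less_todo[OF C v max]
  note b = baseD(2)[OF base] and thin = baseD(10)[OF base] and injp = baseD(7)[OF base]
    and cb = baseD(9)[OF base] and full = baseD(8)[OF base]
  have v0: "blk v = 0" using baseD(5)[OF base] v(1) by blast
  have cL: "c \<in> L v" and cA: "c \<notin> avoided j C col blk b"
    and cN: "card (coloured_neighbours col v c) < d" using adm by (auto simp: admissible_def)
  have cdone: "c \<notin> col ` coloured_part j C" using coloured_part_colours_avoided[OF inv todo(1)] cA by blast
  have B: "?B = b \<or> ?B = b + 1" by (simp add: next_block_def)
  have Bb: "?B = b \<Longrightarrow> c \<notin> col ` block blk b \<and> free blk b \<noteq> 0"
    by (auto simp: next_block_def split: if_splits)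
  have Bb1: "?B = b + 1 \<Longrightarrow> free blk b < todo j C"
    using cA todo by (auto simp: next_block_def avoided_def split: if_splits)
  have blocks: "block ?blk b' = (if b' = ?B then insert v (block blk b') else block blk b')"
    if "1 \<le> b'" for b'
    using that v v0 by (auto simp: block_def)
  have v_nb: "v \<notin> block blk b'" if "1 \<le> b'" for b' using that v0 by (auto simp: block_def)
  have coloured_part': "coloured_part j ?C = insert v (coloured_part j C)" "v \<notin> coloured_part j C" using v by (auto simp: coloured_part_def)
  have todo': "todo j ?C = todo j C - 1" using coloured_part' C by (simp add: todo_def)
  have colim: "?col ` X = col ` X" if "v \<notin> X" for X using that by (auto simp: image_iff)
  have colins: "?col ` insert v X = insert c (col ` X)" if "v \<notin> X" for X
    by (simp only: image_insert fun_upd_same colim[OF that])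
  \<comment> \<open>In block \<open>b\<close> the colour is new by the definition of
    \<open>next_block\<close>; block b + 1 contains only vertices of the present part, whose colours
    differ from \<open>c\<close>.\<close>
  have distinct: "(?blk w, ?col w) \<noteq> (?B, c)" if "w \<in> C" for w
  proof
    assume eq: "(?blk w, ?col w) = (?B, c)"
    have "w \<noteq> v" using that v by blast
    with eq have e: "blk w = ?B" "col w = c" by auto
    show False
    proof (cases "?B = b")
      case True then show False using e Bb that C by (auto simp: block_def)
    next
      case False
      then have "P w = j" using blk that e B by auto
      then show False using cdone e that by (auto simp: coloured_part_def)
    qed
  qed
  have free': "free ?blk b = (if ?B = b then free blk b - 1 else free blk b)"
    using blocks[of b] v_nb[of b] b by (auto simp: free_def)
  have "inj_on (\<lambda>w. (?blk w, ?col w)) C"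
    using injp v by (auto simp: inj_on_def)
  then have inj': "inj_on (\<lambda>w. (?blk w, ?col w)) ?C"
    using distinct by (force simp: image_iff)
  have base': "base ?C ?col ?blk b"
    unfolding base_def
  proof (intro conjI)
    show "card (block ?blk b) \<le> t"
      using blocks[OF b] v_nb[OF b] cb Bb by (auto simp: free_def)
    show "\<forall>b'. 1 \<le> b' \<and> b' < b \<longrightarrow> card (block ?blk b') = t"
      using blocks full B by auto
    show "\<forall>w\<in>?C. ?col w \<in> L w \<and> 1 \<le> ?blk w"
      using baseD(3,4)[OF base] cL b B by auto
    show "\<forall>w\<in>V - ?C. ?blk w = 0 \<and> ?col w = 0" using baseD(5,6)[OF base] by auto
    show "thin ?C ?col" using thin_insert[OF thin _ C cN] v by simp
    show "?C \<subseteq> V" using C v by simp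
    show "1 \<le> b" by (rule b)
    show "inj_on (\<lambda>w. (?blk w, ?col w)) ?C" by (rule inj')
  qed
  have cov': "free ?blk b = 0 \<or> ?col ` coloured_part j ?C \<subseteq> ?col ` block ?blk b"
  proof (cases "free blk b = 0")
    case True then show ?thesis using free' by auto
  next
    case False
    then have cov: "col ` coloured_part j C \<subseteq> col ` block blk b" using cov by simp
    have vb: "v \<notin> block blk b" using v_nb b by simp
    have im: "?col ` coloured_part j ?C = insert c (col ` coloured_part j C)"
      by (simp only: coloured_part'(1) colins[OF coloured_part'(2)])
    show ?thesis
    proof (cases "?B = b")
      case True
      then have "block ?blk b = insert v (block blk b)" using blocks[OF b] by simp
      then have "?col ` block ?blk b = insert c (col ` block blk b)"
        by (simp only: colins[OF vb])
      then show ?thesis using im cov by blast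
    next
      case f: False
      then have c: "c \<in> col ` block blk b" using False unfolding next_block_def by metis
      have "b \<noteq> ?B" using f by simp
      then have e: "?col ` block ?blk b = col ` block blk b"
        by (simp only: blocks[OF b] if_False colim[OF vb])
      show ?thesis by (simp only: im e insert_subset c cov simp_thms)
    qed
  qed
  have slots': "block ?blk (b + 1) = {} \<and> todo j ?C \<le> free ?blk b \<or>
      free ?blk b \<le> todo j ?C \<and> (coloured_part j V = {} \<or> card (coloured_part j V) = k)"
  proof (cases "?B = b")
    case True
    then show ?thesis using slots blocks[of "b + 1"] free' todo' by auto
  next
    case False
    then have "free blk b < todo j C" "?B = b + 1" using B Bb1 by auto
    then show ?thesis using slots free' todo' False by auto
  qed
  have "inj_on ?col (coloured_part j ?C)"
    using inj cdone coloured_part' by (auto simp: inj_on_def)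
  moreover have "\<forall>w\<in>?C. P w \<le> j" "\<forall>w\<in>V. P w < j \<longrightarrow> w \<in> ?C" using lt ge v by auto
  moreover have "\<forall>w\<in>?C. ?blk w \<le> b + 1 \<and> (?blk w = b + 1 \<longrightarrow> P w = j)"
    using blk v B by auto
  ultimately show ?thesis
    unfolding part_inv_def using base' cov' slots' by simp
qed

lemma part_inv_next:
  assumes inv: "part_inv j C col blk b" and all: "coloured_part j V \<subseteq> C"
    and b': "b' = (if card (block blk b) = t then b + 1 else b)"
  shows "part_inv (j + 1) C col blk b'"
proof -
  note base = part_invD(1)[OF inv] and C = part_invD(2)[OF inv] and lt = part_invD(3)[OF inv]
    and ge = part_invD(4)[OF inv] and blk = part_invD(5,6)[OF inv] and slots = part_invD(9)[OF inv]
  note b = baseD(2)[OF base] and cb = baseD(9)[OF base] and full = baseD(8)[OF base]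
  have dj: "coloured_part j C = coloured_part j V" using all C by (auto simp: coloured_part_def)
  have dj1: "coloured_part (j + 1) C = {}" using lt by (auto simp: coloured_part_def)
  have sub: "block blk (b + 1) \<subseteq> coloured_part j V"
    using block_subset[OF base, of "b + 1"] blk C by (auto simp: coloured_part_def block_def)
  have empty: "block blk (b + 1) = {}" if "card (block blk b) \<noteq> t"
  proof (rule ccontr)
    assume ne: "block blk (b + 1) \<noteq> {}"
    then have "free blk b \<le> todo j C" "card (coloured_part j V) = k" using slots sub by auto
    then show False using dj that cb by (simp add: todo_def free_def)
  qed
  have le: "card (block blk (b + 1)) \<le> t"
    using card_mono[OF _ sub] finV card_coloured_part_le[of j] k_le_t by (simp add: coloured_part_def)
  have base': "base C col blk b'"
    using base le full b' unfolding base_def by (auto simp: less_Suc_eq)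
  have blk': "blk w \<le> b'" if "w \<in> C" for w
    using blk that empty C b' by (auto simp: le_Suc_eq block_def)
  have emp': "block blk (b' + 1) = {}"
    using block_subset[OF base', of "b' + 1"] blk' by (fastforce simp: block_def)
  have todo': "todo (j + 1) C = k" using dj1 by (simp add: todo_def)
  have slots': "block blk (b' + 1) = {} \<and> todo (j + 1) C \<le> free blk b' \<or>
      free blk b' \<le> todo (j + 1) C \<and> (coloured_part (j + 1) V = {} \<or> card (coloured_part (j + 1) V) = k)"
  \<comment> \<open>The part to come is part 1 exactly if \<open>j\<close> is 0. It may be too small
    for the second alternative, but then nothing is coloured yet and the empty block offers t \<ge>
    k places. Any other part is empty or has exactly \<open>k\<close> vertices, so comparing
    \<open>k\<close> with the free places is enough.\<close>
  proof (cases "j = 0")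
    case True
    then have "C = {}" using lt P_pos C by fastforce
    then have "block blk b' = {}" using block_subset[OF base' baseD(2)[OF base']] by simp
    then show ?thesis using emp' todo' k_le_t by (simp add: free_def)
  next
    case False
    then show ?thesis using part_eq[of "j + 1"] todo' emp' by (simp add: coloured_part_def) linarith
  qed
  have "\<forall>w\<in>V. P w < j + 1 \<longrightarrow> w \<in> C" using ge all by (auto simp: coloured_part_def less_Suc_eq)
  moreover have "\<forall>w\<in>C. P w \<le> j + 1" using lt by auto
  moreover have "\<forall>w\<in>C. blk w \<le> b' + 1 \<and> (blk w = b' + 1 \<longrightarrow> P w = j + 1)"
    using blk' by fastforce
  ultimately show ?thesis unfolding part_inv_def using base' dj1 slots' by auto
qed

text \<open>No vertex has part index 0, so starting there lets every part, the first included, be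
  entered by \<open>part_inv_next\<close>.\<close>

lemma part_inv_init: "part_inv 0 {} (\<lambda>_. 0) (\<lambda>_. 0) 1"
  using k_le_t P_pos by (auto simp: part_inv_def base_def thin_def coloured_part_def block_def free_def todo_def)

text \<open>Vertices in block b + 1 would belong to part \<open>j\<close>, so there are none: blocks
  1 to b - 1 are full, block \<open>b\<close> holds the rest, and a colour class has at most one
  vertex in each. For degeneracy, the vertex supplied by \<open>thin\<close> has degree less than
  \<open>d\<close> in any monochromatic subgraph on the same vertices.\<close>

lemma part_inv_complete:
  assumes inv: "part_inv j V col blk b" and j: "\<And>v. v \<in> V \<Longrightarrow> P v < j"
  shows "equitable_list_colouring t (d - 1) V E L col"
proof -
  note base = part_invD(1)[OF inv]
  note colL = baseD(3)[OF base] and b1 = baseD(4)[OF base] and b = baseD(2)[OF base]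
    and inj = baseD(7)[OF base] and full = baseD(8)[OF base] and thin = baseD(10)[OF base]
  have blk: "\<forall>w\<in>V. blk w \<le> b"
    using part_invD(5,6)[OF inv] j by (metis Suc_eq_plus1 le_Suc_eq less_irrefl)
  have t: "t \<ge> 1" using k_pos k_le_t by simp
  have deg: "degenerate (d - 1) (colour_class V col i) (induced_edges E (colour_class V col i))" for i
    unfolding degenerate_def
  proof (intro allI impI, elim conjE)
    fix W F assume sub: "subgraph W F (colour_class V col i) (induced_edges E (colour_class V col i))"
      and ne: "W \<noteq> {}"
    then have W: "W \<subseteq> V" "\<forall>w\<in>W. col w = i" and F: "F \<subseteq> E" "\<forall>e\<in>F. e \<subseteq> W"
      by (auto simp: subgraph_def colour_class_def induced_edges_def finite_graph_def)
    obtain v where v: "v \<in> W" "card (neighbours E v \<inter> W) < d"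
      using thin W ne unfolding thin_def by (metis (no_types, lifting))
    have finW: "finite W" using W(1) finV finite_subset by blast
    have "neighbours F v \<subseteq> neighbours E v \<inter> W" using F by (auto simp: neighbours_def)
    then have "card (neighbours F v) \<le> card (neighbours E v \<inter> W)"
      using finW by (intro card_mono) auto
    moreover have "min_degree W F \<le> card (neighbours F v)"
      unfolding min_degree_def using finW v(1) by (intro Min_le) auto
    ultimately show "min_degree W F \<le> d - 1" using v(2) by linarith
  qed
  have size: "int (card (colour_class V col i)) \<le> \<lceil>real (card V) / real t\<rceil>" for i
  proof -
    have "inj_on blk (colour_class V col i)"
      using inj by (auto simp: inj_on_def colour_class_def)
    moreover have "blk ` colour_class V col i \<subseteq> blk ` V" by (auto simp: colour_class_def)
    ultimately have m: "card (colour_class V col i) \<le> card (blk ` V)"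
      using finV by (metis card_mono card_image finite_imageI)
    have "t * (b - 1) = (\<Sum>b'\<in>{1..<b}. card (block blk b'))" using full by simp
    also have "\<dots> = card (\<Union>b'\<in>{1..<b}. block blk b')"
      by (rule card_UN_disjoint[symmetric]) (use finV in \<open>auto simp: block_def\<close>)
    also have "(\<Union>b'\<in>{1..<b}. block blk b') = V - block blk b"
      using blk b1 by (fastforce simp: block_def)
    also have "card \<dots> = card V - card (block blk b)"
      by (rule card_Diff_subset) (auto simp: block_def finV)
    finally have tot: "t * (b - 1) = card V - card (block blk b)" .
    have bV: "card (block blk b) \<le> card V" by (rule card_mono) (auto simp: block_def finV)
    show ?thesis
    \<comment> \<open>An empty block \<open>b\<close> must not be counted: then the b - 1 full
      blocks give |V| / t exactly. Otherwise t(b - 1) < |V|, which makes \<open>b\<close> at most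
      the rounded-up quotient.\<close>
    proof (cases "block blk b = {}")
      case True
      then have "blk ` V \<subseteq> {1..<b}" using blk b1 by (force simp: block_def)
      then have "card (blk ` V) \<le> b - 1" using card_mono[of "{1..<b}" "blk ` V"] by simp
      moreover have "card V = t * (b - 1)" using True tot by simp
      then have "real (card V) / real t = real (b - 1)" using t by simp
      ultimately show ?thesis using m by simp
    next
      case False
      have "blk ` V \<subseteq> {1..b}" using blk b1 by auto
      then have "card (blk ` V) \<le> b" using card_mono[of "{1..b}" "blk ` V"] by simp
      moreover have "1 \<le> card (block blk b)" using False by (simp add: Suc_le_eq card_gt_0_iff)
      then have "t * (b - 1) < card V" using tot bV False by linarith
      then have "real (t * (b - 1)) < real (card V)" by linarith
      then have "real (b - 1) < real (card V) / real t" using t by (simp add: field_simps)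
      ultimately show ?thesis using m b by linarith
    qed
  qed
  show ?thesis
    unfolding equitable_list_colouring_def list_colouring_def using deg size colL by simp
qed

section \<open>Existence of an equitable list colouring\<close>

lemma part_exists:
  assumes "part_inv j C col blk b"
    and "\<And>w u. w \<in> coloured_part j C \<Longrightarrow> u \<in> coloured_part j V - C \<Longrightarrow> back_degree V E P u \<le> back_degree V E P w"
  shows "\<exists>C col blk. part_inv j C col blk b \<and> coloured_part j V \<subseteq> C"
  using assms
proof (induction "card (coloured_part j V - C)" arbitrary: C col blk rule: less_induct)
  case less
  show ?case
  proof (cases "coloured_part j V \<subseteq> C")
    case True then show ?thesis using less.prems by blast
  next
    case False
    define R where "R = coloured_part j V - C"
    have R: "finite R" "R \<noteq> {}" using False finV by (auto simp: R_def)
    \<comment> \<open>Choosing an uncoloured vertex of maximal back degree keeps the second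
      assumption true.\<close>
    define m where "m = Max (back_degree V E P ` R)"
    have "m \<in> back_degree V E P ` R" unfolding m_def using R by (intro Max_in) auto
    then obtain v where vR: "v \<in> R" and vm: "back_degree V E P v = m" by auto
    have vmax: "back_degree V E P u \<le> back_degree V E P v" if "u \<in> R" for u
      unfolding vm m_def using that R by (intro Max_ge) auto
    have v: "v \<in> V - C" "P v = j" using vR by (auto simp: R_def coloured_part_def)
    have max: "back_degree V E P v \<le> back_degree V E P w" if "w \<in> coloured_part j C" for w
      using less.prems(2) that vR by (auto simp: R_def)
    obtain c where "admissible j C col blk b v c"
      using admissible_exists[OF less.prems(1) v max] by blast
    note step = part_inv_step[OF less.prems(1) v max this]
    show ?thesis
    proof (rule less.hyps[OF _ step])
      have "coloured_part j V - insert v C = R - {v}" by (auto simp: R_def)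
      then show "card (coloured_part j V - insert v C) < card (coloured_part j V - C)"
        using R(1) vR unfolding R_def by (metis card_Diff1_less)
      fix w u assume "w \<in> coloured_part j (insert v C)" "u \<in> coloured_part j V - insert v C"
      then show "back_degree V E P u \<le> back_degree V E P w"
        using vmax less.prems(2) by (auto simp: coloured_part_def R_def)
    qed
  qed
qed

lemma equitable_exists: "\<exists>col. equitable_list_colouring t (d - 1) V E L col"
proof -
  have inv: "\<exists>C col blk b. part_inv j C col blk b \<and> coloured_part j C = {}" for j
  proof (induction j)
    case 0
    show ?case using part_inv_init by (fastforce simp: coloured_part_def)
  next
    case (Suc j)
    then obtain C col blk b where "part_inv j C col blk b" "coloured_part j C = {}" by blast
    then obtain C col blk where inv: "part_inv j C col blk b" "coloured_part j V \<subseteq> C"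
      using part_exists[of j C col blk b] by auto
    then have "coloured_part (j + 1) C = {}"
      using part_invD(3)[OF inv(1)] by (auto simp: coloured_part_def)
    then show ?case using part_inv_next[OF inv refl] by auto
  qed
  \<comment> \<open>An index beyond all parts, so that everything is coloured when it is reached.
    For empty \<open>V\<close> the value of \<open>Max\<close> is arbitrary, but then no vertex has
    to be compared with \<open>j\<close>.\<close>
  define j where "j = Suc (Max (P ` V))"
  have j: "P v < j" if "v \<in> V" for v
    unfolding j_def using that finV by (simp add: le_imp_less_Suc)
  obtain C col blk b where C: "part_inv j C col blk b" using inv by blast
  have "C = V" using part_invD(2,4)[OF C] j by blast
  then show ?thesis using part_inv_complete[of j col blk b] C j by blast
qed

end

section \<open>From (k,d)-partitions to instances of the greedy colouring\<close>

lemma kd_partition_part: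
  assumes part: "kd_partition k d V E \<eta> S"
    and P: "\<And>v. v \<in> V \<Longrightarrow> P v \<in> {1..\<eta> + 1} \<and> v \<in> S (P v)"
    and j: "j \<in> {1..\<eta> + 1}"
  shows "{v \<in> V. P v = j} = S j"
proof -
  have V: "(\<Union>j\<in>{1..\<eta> + 1}. S j) = V" and dis: "disjoint_family_on S {1..\<eta> + 1}"
    using part by (auto simp: kd_partition_def)
  have "P v = j" if "v \<in> S j" for v
  proof (rule ccontr)
    assume "P v \<noteq> j"
    moreover have "v \<in> V" using that V j by blast
    ultimately show False
      using dis P[of v] j that unfolding disjoint_family_on_def by blast
  qed
  then show ?thesis using P V j by blast
qed

text \<open>Each of the \<eta> parts after the first has at least one vertex. This bounds the number
  of rounds of the program by the number of vertices.\<close>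

lemma kd_partition_length:
  assumes part: "kd_partition k d V E \<eta> S" and "finite V" "1 \<le> k"
  shows "\<eta> \<le> card V"
proof -
  have dis: "disjoint_family_on S {1..\<eta> + 1}" and V: "(\<Union>j\<in>{1..\<eta> + 1}. S j) = V"
    and k: "\<And>j. j \<in> {2..\<eta> + 1} \<Longrightarrow> card (S j) = k"
    using part by (auto simp: kd_partition_def)
  have fin: "finite (S j)" if "j \<in> {2..\<eta> + 1}" for j
    using k[OF that] \<open>1 \<le> k\<close> by (metis card.infinite not_one_le_zero)
  have "\<eta> \<le> (\<Sum>j\<in>{2..\<eta> + 1}. k)" using \<open>1 \<le> k\<close> by simp
  also have "\<dots> = (\<Sum>j\<in>{2..\<eta> + 1}. card (S j))" using k by simp
  also have "\<dots> = card (\<Union>j\<in>{2..\<eta> + 1}. S j)"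
    using dis fin by (intro card_UN_disjoint[symmetric]) (auto simp: disjoint_family_on_def)
  also have "\<dots> \<le> card V"
    using V \<open>finite V\<close> by (intro card_mono) auto
  finally show ?thesis .
qed

text \<open>For \<open>high_back_degree\<close>: the m-th vertex in the ordering of a part has back
  degree less than dm, so back degree at least di forces m > i and leaves k - i positions. Vertices
  of part 1 have back degree 0.\<close>

lemma list_instance_kd_partition:
  assumes G: "finite_graph V E" and part: "kd_partition k d V E \<eta> S"
    and P: "\<And>v. v \<in> V \<Longrightarrow> P v \<in> {1..\<eta> + 1} \<and> v \<in> S (P v)"
    and L: "list_assignment V L" "uniform_lists t V L"
    and num: "1 \<le> k" "1 \<le> d" "k \<le> t"
  shows "list_instance V E P L k d t"
proof
  show fin: "finite V" using G by (simp add: finite_graph_def)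
  have S: "{v \<in> V. P v = j} = S j" if "j \<in> {1..\<eta> + 1}" for j
    using kd_partition_part[OF part _ that] P by blast
  have out: "{v \<in> V. P v = j} = {}" if "j \<notin> {1..\<eta> + 1}" for j using P that by auto
  have card1: "card (S 1) \<le> k" and cardk: "\<And>j. j \<in> {2..\<eta> + 1} \<Longrightarrow> card (S j) = k"
    using part by (auto simp: kd_partition_def)
  have cases: "j \<notin> {1..\<eta> + 1} \<or> j = 1 \<or> j \<in> {2..\<eta> + 1}" for j by auto
  show "card {v \<in> V. P v = j} \<le> k" for j
  proof (cases "j \<in> {1..\<eta> + 1}")
    case True
    have "card (S j) \<le> k" using cases[of j] True card1 cardk[of j] by auto
    then show ?thesis by (simp only: S[OF True])
  qed (simp only: out card.empty zero_le simp_thms)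
  show "{v \<in> V. P v = j} = {} \<or> card {v \<in> V. P v = j} = k" if "j \<noteq> 1" for j
  proof (cases "j \<in> {1..\<eta> + 1}")
    case True
    have "card (S j) = k" using cases[of j] True that cardk[of j] by auto
    then show ?thesis by (simp only: S[OF True] simp_thms)
  qed (simp only: out simp_thms)
  show "card {v \<in> V. P v = j \<and> d * i \<le> back_degree V E P v} \<le> k - i" if i: "1 \<le> i" "i \<le> k" for i j
  proof (cases "j \<in> {2..\<eta> + 1}")
    case False
    have "\<not> (P v = j \<and> d * i \<le> back_degree V E P v)" if "v \<in> V" for v
    proof (cases "j = 1")
      case True
      have none: "{u \<in> V. P u < 1} = {}" using P by fastforce
      have "back_degree V E P v = 0" if "P v = 1"
        unfolding back_degree_def that none by simp
      then show ?thesis using i num True by auto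
    next
      case f: False
      then show ?thesis using False P[OF that] by auto
    qed
    then have "{v \<in> V. P v = j \<and> d * i \<le> back_degree V E P v} = {}" by blast
    then show ?thesis by (simp only: card.empty zero_le)
  next
    case True
    then obtain x where x: "bij_betw x {1..k} (S j)"
      and nb: "\<And>i. i \<in> {1..k} \<Longrightarrow> card (neighbours E (x i) \<inter> (\<Union>l\<in>{1..j - 1}. S l)) \<le> d * i - 1"
      using part unfolding kd_partition_def by blast
    have j: "j \<in> {1..\<eta> + 1}" using True by auto
    have before: "{u \<in> V. P u < j} = (\<Union>l\<in>{1..j - 1}. S l)"
    proof -
      have "{u \<in> V. P u < j} = (\<Union>l\<in>{1..j - 1}. {u \<in> V. P u = l})" using P by fastforce
      also have "\<dots> = (\<Union>l\<in>{1..j - 1}. S l)" by (intro SUP_cong refl S) (use j in auto)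
      finally show ?thesis .
    qed
    have "{v \<in> V. P v = j \<and> d * i \<le> back_degree V E P v} \<subseteq> x ` {i<..k}"
    proof
      fix v assume v: "v \<in> {v \<in> V. P v = j \<and> d * i \<le> back_degree V E P v}"
      then have "v \<in> S j" using P by blast
      then obtain m where m: "m \<in> {1..k}" "v = x m"
        using x unfolding bij_betw_def by blast
      have "back_degree V E P v \<le> d * m - 1" using nb[OF m(1)] v m(2) before by (auto simp: back_degree_def)
      \<comment> \<open>Positivity turns the truncated bound d * m - 1 into the strict bound d *
        m.\<close>
      moreover have "1 \<le> d * m" using m(1) num by simp
      moreover have "d * i \<le> back_degree V E P v" using v by simp
      ultimately have "d * i < d * m" by linarith
      then have "i < m" by simp
      then show "v \<in> x ` {i<..k}" using m by auto
    qed
    then have "card {v \<in> V. P v = j \<and> d * i \<le> back_degree V E P v} \<le> card (x ` {i<..k})"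
      by (rule card_mono[rotated]) simp
    also have "\<dots> \<le> card {i<..k}" by (rule card_image_le) simp
    finally show ?thesis by simp
  qed
qed (use P L num in \<open>force simp: list_assignment_def uniform_lists_def\<close>)+

theorem equitably_choosable_kd_partition:
  assumes G: "finite_graph V E" and part: "kd_partition k d V E \<eta> S"
    and num: "1 \<le> k" "1 \<le> d" "k \<le> t"
  shows "equitably_choosable t (d - 1) V E"
  unfolding equitably_choosable_def
proof (intro allI impI, elim conjE)
  fix L assume L: "list_assignment V L" "uniform_lists t V L"
  have "\<forall>v\<in>V. \<exists>j. j \<in> {1..\<eta> + 1} \<and> v \<in> S j" using part unfolding kd_partition_def by blast
  then obtain P where "\<forall>v\<in>V. P v \<in> {1..\<eta> + 1} \<and> v \<in> S (P v)" by metis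
  then interpret list_instance V E P L k d t
    by (intro list_instance_kd_partition[OF G part _ L num]) blast
  show "\<exists>c. equitable_list_colouring t (d - 1) V E L c" by (rule equitable_exists)
qed

section \<open>Running times of structured programs\<close>

text \<open>Keeping an upper bound instead of the exact number of steps allows uniform estimates for
  branches and loops whose course depends on the data.\<close>

definition runs :: "com \<Rightarrow> nat \<Rightarrow> state \<Rightarrow> state \<Rightarrow> bool" where
  "runs p T s s' \<longleftrightarrow> (\<exists>T'\<le>T. exec p s T' s')"

text \<open>The frame condition of a program that writes only to arrays in \<open>X\<close>.\<close>

definition agree :: "string set \<Rightarrow> state \<Rightarrow> state \<Rightarrow> bool" where
  "agree X s s' \<longleftrightarrow> (\<forall>y. y \<notin> X \<longrightarrow> s' y = s y)"

lemma agreeD: "agree X s s' \<Longrightarrow> y \<notin> X \<Longrightarrow> s' y = s y"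
  by (simp add: agree_def)

lemma agree_trans: "agree X s s' \<Longrightarrow> agree Y s' s'' \<Longrightarrow> X \<union> Y \<subseteq> Z \<Longrightarrow> agree Z s s''"
  unfolding agree_def by (metis UnCI in_mono)

lemma agree_upd: "agree X s s' \<Longrightarrow> x \<in> X \<Longrightarrow> agree X s (s'(x := f))"
  by (auto simp: agree_def)

lemma agree_refl: "agree X s s"
  by (simp add: agree_def)

lemma runs_mono: "runs p T s s' \<Longrightarrow> T \<le> T' \<Longrightarrow> runs p T' s s'"
  unfolding runs_def by (meson le_trans)

lemma runs_Skip: "runs Skip 1 s s"
  unfolding runs_def by (blast intro: exec.Skip)

lemma runs_Assign:
  "runs (Assign x a b) (acost a + acost b + 1) s (s(x := (s x)(aval a s := aval b s)))"
  unfolding runs_def by (blast intro: exec.Assign)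

lemma runs_Seq: "runs p T1 s s1 \<Longrightarrow> runs q T2 s1 s2 \<Longrightarrow> runs (Seq p q) (T1 + T2) s s2"
  unfolding runs_def by (meson add_mono exec.Seq)

text \<open>The bounds of both branches are added instead of maximised; so time bounds remain sums
  and products.\<close>

lemma runs_Cond:
  assumes "aval a s \<noteq> 0 \<Longrightarrow> runs p T1 s s'" "aval a s = 0 \<Longrightarrow> runs q T2 s s'"
  shows "runs (Cond a p q) (acost a + 1 + T1 + T2) s s'"
proof (cases "aval a s = 0")
  case True
  then obtain T' where "exec q s T' s'" "T' \<le> T2" using assms(2) by (auto simp: runs_def)
  with exec.CondFalse[of a s q T' s' p] True show ?thesis
    unfolding runs_def by (intro exI[of _ "acost a + 1 + T'"]) auto
next
  case False
  then obtain T' where "exec p s T' s'" "T' \<le> T1" using assms(1) by (auto simp: runs_def)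
  with exec.CondTrue[of a s p T' s' q] False show ?thesis
    unfolding runs_def by (intro exI[of _ "acost a + 1 + T'"]) auto
qed

lemma runs_Cond_ex:
  assumes "aval a s \<noteq> 0 \<Longrightarrow> \<exists>s'. runs p T1 s s' \<and> R s'"
    and "aval a s = 0 \<Longrightarrow> \<exists>s'. runs q T2 s s' \<and> R s'"
  shows "\<exists>s'. runs (Cond a p q) (acost a + 1 + T1 + T2) s s' \<and> R s'"
proof (cases "aval a s = 0")
  case True
  then obtain s' where s': "runs q T2 s s'" "R s'" using assms(2) by blast
  have "runs (Cond a p q) (acost a + 1 + T1 + T2) s s'"
    by (rule runs_Cond) (use True s' in simp_all)
  then show ?thesis using s'(2) by blast
next
  case False
  then obtain s' where s': "runs p T1 s s'" "R s'" using assms(1) by blast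
  have "runs (Cond a p q) (acost a + 1 + T1 + T2) s s'"
    by (rule runs_Cond) (use False s' in simp_all)
  then show ?thesis using s'(2) by blast
qed

section \<open>Derived expressions, counting loops and their costs\<close>

definition Var :: "string \<Rightarrow> aexp" where
  "Var x = Arr x (Num 0)"

definition Set :: "string \<Rightarrow> aexp \<Rightarrow> com" where
  "Set x a = Assign x (Num 0) a"

text \<open>Truth values are encoded as 0 and 1; the outer truncated subtractions turn any positive
  number into 1.\<close>

definition Less :: "aexp \<Rightarrow> aexp \<Rightarrow> aexp" where
  "Less a b = Minus (Num 1) (Minus (Num 1) (Minus b a))"

definition Equal :: "aexp \<Rightarrow> aexp \<Rightarrow> aexp" where
  "Equal a b = Minus (Num 1) (Plus (Minus a b) (Minus b a))"

definition Both :: "aexp \<Rightarrow> aexp \<Rightarrow> aexp" where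
  "Both a b = Minus (Num 1) (Plus (Minus (Num 1) a) (Minus (Num 1) b))"

lemma aval_macros [simp]:
  "aval (Var x) s = s x 0"
  "aval (Less a b) s = of_bool (aval a s < aval b s)"
  "aval (Equal a b) s = of_bool (aval a s = aval b s)"
  "aval (Both a b) s = of_bool (0 < aval a s \<and> 0 < aval b s)"
  by (auto simp: Var_def Less_def Equal_def Both_def)

lemma acost_macros [simp]:
  "acost (Var x) = 2"
  "acost (Less a b) = acost a + acost b + 5"
  "acost (Equal a b) = 2 * acost a + 2 * acost b + 5"
  "acost (Both a b) = acost a + acost b + 7"
  by (auto simp: Var_def Less_def Equal_def Both_def)

lemma runs_Set: "runs (Set x a) (acost a + 2) s (s(x := (s x)(0 := aval a s)))"
  using runs_Assign[of x "Num 0" a s] by (simp add: Set_def)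

definition For :: "string \<Rightarrow> aexp \<Rightarrow> com \<Rightarrow> com" where
  "For x a p = Seq (Set x (Num 0))
     (While (Minus a (Var x)) (Seq p (Set x (Plus (Var x) (Num 1)))))"

text \<open>Here \<open>c\<close> is the cost of the loop bound. Initialising the counter costs 3,
  each evaluation of the loop test c + 4, including the final one, and each increment 6.\<close>

definition for_time :: "nat \<Rightarrow> nat \<Rightarrow> nat \<Rightarrow> nat" where
  "for_time c m T = 3 + (m * (c + T + 10) + c + 4)"

text \<open>Induction on the number M - m of remaining rounds. The invariant \<open>J\<close> is
  indexed by the counter and demanded after the increment, while the body itself has to leave the
  counter at \<open>m\<close>.\<close>

lemma runs_For:
  assumes init: "J 0 (s(x := (s x)(0 := 0)))"
    and bound: "\<And>m s. J m s \<Longrightarrow> aval a s = M \<and> s x 0 = m"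
    and step: "\<And>m s. J m s \<Longrightarrow> m < M \<Longrightarrow>
      \<exists>s'. runs p T s s' \<and> s' x 0 = m \<and> J (m + 1) (s'(x := (s' x)(0 := m + 1)))"
  shows "\<exists>s'. runs (For x a p) (for_time (acost a) M T) s s' \<and> J M s'"
proof -
  let ?p = "Seq p (Set x (Plus (Var x) (Num 1)))"
  let ?w = "While (Minus a (Var x)) ?p"
  have c: "acost (Minus a (Var x)) + 1 = acost a + 4" by simp
  have loop: "\<exists>s'. runs ?w ((M - m) * (acost a + T + 10) + acost a + 4) s s' \<and> J M s'"
    if "J m s" "m \<le> M" for m s
    using that
  proof (induction "M - m" arbitrary: m s)
    case 0
    then have "aval (Minus a (Var x)) s = 0" "m = M" using bound[of m s] by auto
    from exec.WhileFalse[OF this(1), of ?p] have "exec ?w s (acost a + 4) s" by (simp only: c)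
    then have "runs ?w (acost a + 4) s s" unfolding runs_def by blast
    then show ?case using 0 \<open>m = M\<close> by auto
  next
    case (Suc l)
    then have m: "m < M" and l: "l = M - (m + 1)" by auto
    obtain s' where s': "runs p T s s'" "s' x 0 = m" "J (m + 1) (s'(x := (s' x)(0 := m + 1)))"
      using step[OF Suc.prems(1) m] by blast
    let ?s = "s'(x := (s' x)(0 := m + 1))"
    obtain T1 where T1: "exec p s T1 s'" "T1 \<le> T" using s'(1) by (auto simp: runs_def)
    have "exec (Set x (Plus (Var x) (Num 1))) s' 6 ?s"
      using exec.Assign[of x "Num 0" "Plus (Var x) (Num 1)" s'] s'(2) by (simp add: Set_def)
    with T1 have body: "exec (Seq p (Set x (Plus (Var x) (Num 1)))) s (T1 + 6) ?s"
      by (blast intro: exec.Seq)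
    obtain s2 T2 where s2: "exec ?w ?s T2 s2" "T2 \<le> l * (acost a + T + 10) + acost a + 4" "J M s2"
      using Suc.hyps(1)[OF l s'(3)] m l by (auto simp: runs_def)
    have "aval (Minus a (Var x)) s \<noteq> 0" using bound[OF Suc.prems(1)] m by simp
    from exec.WhileTrue[OF this body s2(1)]
    have "exec ?w s (acost a + 4 + (T1 + 6) + T2) s2" by (simp only: c)
    moreover have "acost a + 4 + (T1 + 6) + T2 \<le> (M - m) * (acost a + T + 10) + acost a + 4"
      using s2(2) T1(2) Suc.hyps(2)[symmetric] by simp
    ultimately show ?case using s2(3) unfolding runs_def by blast
  qed
  obtain s' where s': "runs ?w (M * (acost a + T + 10) + acost a + 4) (s(x := (s x)(0 := 0))) s'" "J M s'"
    using loop[OF init] by auto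
  have "runs (Set x (Num 0)) 3 s (s(x := (s x)(0 := 0)))"
    using runs_Set[of x "Num 0" s] by (simp add: numeral_eq_Suc)
  from runs_Seq[OF this s'(1)] s'(2) show ?thesis by (auto simp: For_def for_time_def)
qed

text \<open>All cardinalities consulted by the algorithm are found by such a scan through the
  vertices: \<open>a\<close> has value 0 or 1 and refers to the current vertex by
  \<open>w\<close>.\<close>

definition Count :: "string \<Rightarrow> aexp \<Rightarrow> com" where
  "Count r a = Seq (Set r (Num 0)) (For ''w'' (Var ''n'') (Set r (Plus (Var r) a)))"

definition count_time :: "nat \<Rightarrow> nat \<Rightarrow> nat" where
  "count_time c n = 3 + for_time 2 n (c + 5)"

lemma runs_Count:
  assumes r: "r \<notin> {''n'', ''w''}" and n: "s ''n'' 0 = n"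
    and a: "\<And>s' m. agree {r, ''w''} s s' \<Longrightarrow> s' ''w'' 0 = m \<Longrightarrow> m < n \<Longrightarrow> aval a s' = of_bool (Q m)"
  shows "\<exists>s'. runs (Count r a) (count_time (acost a) n) s s' \<and> agree {r, ''w''} s s' \<and>
    s' r 0 = card {m. m < n \<and> Q m}"
proof -
  let ?J = "\<lambda>m s'. agree {r, ''w''} s s' \<and> s' ''w'' 0 = m \<and> s' r 0 = card {l. l < m \<and> Q l}"
  have Suc: "card {l. l < Suc m \<and> Q l} = card {l. l < m \<and> Q l} + of_bool (Q m)" for m
  proof -
    have "{l. l < Suc m \<and> Q l} = (if Q m then insert m else id) {l. l < m \<and> Q l}"
      by (auto simp: less_Suc_eq)
    then show ?thesis by simp
  qed
  let ?s = "s(r := (s r)(0 := 0))"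
  have "\<exists>s'. runs (For ''w'' (Var ''n'') (Set r (Plus (Var r) a)))
      (for_time (acost (Var ''n'')) n (acost a + 5)) ?s s' \<and> ?J n s'"
  proof (rule runs_For[where J = ?J])
    show "?J 0 (?s(''w'' := (?s ''w'')(0 := 0)))" using r by (auto simp: agree_def)
    show "aval (Var ''n'') s' = n \<and> s' ''w'' 0 = m" if "?J m s'" for m s'
      using that r n by (auto simp: agree_def)
    show "\<exists>s''. runs (Set r (Plus (Var r) a)) (acost a + 5) s' s'' \<and> s'' ''w'' 0 = m \<and>
        ?J (m + 1) (s''(''w'' := (s'' ''w'')(0 := m + 1)))" if J: "?J m s'" and m: "m < n" for m s'
    proof -
      let ?s' = "s'(r := (s' r)(0 := card {l. l < m \<and> Q l} + of_bool (Q m)))"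
      have step: "runs (Set r (Plus (Var r) a)) (acost a + 5) s' ?s'"
        using runs_Set[of r "Plus (Var r) a" s'] a[of s' m] J m by (simp add: numeral_eq_Suc)
      have "agree {r, ''w''} s (?s'(''w'' := (?s' ''w'')(0 := m + 1)))"
        using J by (simp add: agree_upd)
      then show ?thesis
        using J r by (intro exI[of _ ?s'] conjI step) (auto simp: Suc)
    qed
  qed
  then obtain s' where s': "runs (For ''w'' (Var ''n'') (Set r (Plus (Var r) a)))
      (for_time 2 n (acost a + 5)) ?s s'" "?J n s'" by auto
  have "runs (Set r (Num 0)) 3 s ?s" using runs_Set[of r "Num 0" s] by (simp add: numeral_eq_Suc)
  from runs_Seq[OF this s'(1)] s'(2) show ?thesis
    by (auto simp: Count_def count_time_def)
qed

section \<open>Functions given by polynomials\<close>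

definition is_poly :: "(nat \<Rightarrow> nat) \<Rightarrow> bool" where
  "is_poly f \<longleftrightarrow> (\<exists>Q :: nat poly. \<forall>n. f n = poly Q n)"

lemma is_poly_const [intro, simp]: "is_poly (\<lambda>_. c)"
  unfolding is_poly_def by (rule exI[of _ "[:c:]"]) simp

lemma is_poly_ident [intro, simp]: "is_poly (\<lambda>n. n)"
  unfolding is_poly_def by (rule exI[of _ "[:0, 1:]"]) simp

lemma is_poly_add [intro, simp]: "is_poly f \<Longrightarrow> is_poly g \<Longrightarrow> is_poly (\<lambda>n. f n + g n)"
  unfolding is_poly_def by (metis poly_add)

lemma is_poly_mult [intro, simp]: "is_poly f \<Longrightarrow> is_poly g \<Longrightarrow> is_poly (\<lambda>n. f n * g n)"
  unfolding is_poly_def by (metis poly_mult)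

lemma is_poly_for_time [intro, simp]:
  "is_poly f \<Longrightarrow> is_poly g \<Longrightarrow> is_poly (\<lambda>n. for_time c (f n) (g n))"
  by (simp add: for_time_def)

lemma is_poly_count_time [intro, simp]: "is_poly (count_time c)"
  unfolding count_time_def [abs_def] by simp

section \<open>The colouring program\<close>

text \<open>In the absence of multiplication, the offsets \<open>n * v\<close> and \<open>t * v\<close> of the rows of \<open>v\<close> in the
  adjacency matrix and in the lists are tabulated in \<open>row\<close> and \<open>lrow\<close>. The array \<open>deg\<close> holds
  the values of \<^const>\<open>back_degree\<close>, \<open>blk\<close> the block numbers (0 for uncoloured vertices) and
  \<open>b\<close> the current block; \<open>i\<close> and \<open>f\<close> stand for \<open>todo\<close> and \<open>free\<close>.\<close>

definition adjacent :: aexp where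
  "adjacent = Arr ''adj'' (Plus (Arr ''row'' (Var ''v'')) (Var ''w''))"

definition in_block :: aexp where
  "in_block = Equal (Arr ''blk'' (Var ''w'')) (Var ''b'')"

text \<open>A positive block number marks the coloured vertices, so this tests for membership in
  \<open>coloured_part\<close>.\<close>

definition in_part :: aexp where
  "in_part = Both (Equal (Arr ''part'' (Var ''w'')) (Var ''j'')) (Less (Num 0) (Arr ''blk'' (Var ''w'')))"

definition has_colour :: "string \<Rightarrow> aexp" where
  "has_colour x = Equal (Arr ''col'' (Var ''w'')) (Var x)"

text \<open>Candidate number \<open>q\<close> from the list of \<open>v\<close> is stored in
  \<open>x\<close> iff it is admissible: \<open>r\<close> counts the neighbours of this colour,
  \<open>a\<close> its occurrences in the set to be avoided.\<close>

definition try_colour :: "nat \<Rightarrow> com" where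
  "try_colour d =
     Seq (Set ''c'' (Arr ''list'' (Plus (Arr ''lrow'' (Var ''v'')) (Var ''q''))))
    (Seq (Count ''r'' (Both adjacent (has_colour ''c'')))
    (Seq (Cond (Less (Var ''f'') (Var ''i''))
            (Count ''a'' (Both (has_colour ''c'') in_part))
            (Count ''a'' (Both (has_colour ''c'') in_block)))
         (Cond (Both (Less (Var ''r'') (Num d)) (Equal (Var ''a'') (Num 0)))
            (Set ''x'' (Var ''c'')) Skip)))"

text \<open>The expression for the block computes \<open>next_block\<close>: 1 - f is 1 exactly for
  a full block, \<open>r\<close> counts the vertices of the block with the chosen colour, and the
  sum of both is cut down to 0 or 1 before being added to \<open>b\<close>.\<close>

definition colour_vertex :: "nat \<Rightarrow> nat \<Rightarrow> nat \<Rightarrow> com" where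
  "colour_vertex k d t =
     Seq (Count ''r'' in_part)
    (Seq (Set ''i'' (Minus (Num k) (Var ''r'')))
    (Seq (Count ''r'' in_block)
    (Seq (Set ''f'' (Minus (Num t) (Var ''r'')))
    (Seq (For ''q'' (Num t) (try_colour d))
    (Seq (Count ''r'' (Both (has_colour ''x'') in_block))
    (Seq (Assign ''blk'' (Var ''v'') (Plus (Var ''b'')
            (Minus (Num 1) (Minus (Num 1) (Plus (Minus (Num 1) (Var ''f'')) (Var ''r''))))))
         (Assign ''col'' (Var ''v'') (Var ''x''))))))))"

definition visit :: "nat \<Rightarrow> nat \<Rightarrow> nat \<Rightarrow> com" where
  "visit k d t = Cond (Both (Equal (Arr ''part'' (Var ''v'')) (Var ''j''))
     (Equal (Plus (Arr ''deg'' (Var ''v'')) (Var ''e'')) (Var ''n''))) (colour_vertex k d t) Skip"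

text \<open>Visiting the vertices with \<open>deg v = n - e\<close> for increasing \<open>e\<close> yields the decreasing order
  of the degrees without sorting.\<close>

definition colour_part :: "nat \<Rightarrow> nat \<Rightarrow> nat \<Rightarrow> com" where
  "colour_part k d t =
     Seq (For ''e'' (Plus (Var ''n'') (Num 1)) (For ''v'' (Var ''n'') (visit k d t)))
    (Seq (Count ''r'' in_block)
         (Cond (Equal (Var ''r'') (Num t)) (Set ''b'' (Plus (Var ''b'') (Num 1))) Skip))"

definition prepare_rows :: "nat \<Rightarrow> com" where
  "prepare_rows t =
     Seq (Assign ''row'' (Plus (Var ''v'') (Num 1)) (Plus (Arr ''row'' (Var ''v'')) (Var ''n'')))
         (Assign ''lrow'' (Plus (Var ''v'') (Num 1)) (Plus (Arr ''lrow'' (Var ''v'')) (Num t)))"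

definition prepare_degree :: com where
  "prepare_degree =
     Seq (Count ''r'' (Both adjacent
            (Less (Arr ''part'' (Var ''w'')) (Arr ''part'' (Var ''v'')))))
         (Assign ''deg'' (Var ''v'') (Var ''r''))"

text \<open>The number of parts is not given in the input, but it is at most n + 1. So
  \<open>j\<close> runs from 0 to n + 1, where the round for 0 colours nothing.\<close>

definition colouring_program :: "nat \<Rightarrow> nat \<Rightarrow> nat \<Rightarrow> com" where
  "colouring_program k d t =
     Seq (For ''v'' (Var ''n'') (prepare_rows t))
    (Seq (For ''v'' (Var ''n'') prepare_degree)
    (Seq (Set ''b'' (Num 1))
         (For ''j'' (Plus (Var ''n'') (Num 2)) (colour_part k d t))))"

section \<open>Time bounds for the components of the program\<close>

definition try_time :: "nat \<Rightarrow> nat" where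
  "try_time n = count_time (acost (Both adjacent (has_colour ''c''))) n
     + count_time (acost (Both (has_colour ''c'') in_part)) n
     + count_time (acost (Both (has_colour ''c'') in_block)) n + 100"

definition vertex_time :: "nat \<Rightarrow> nat \<Rightarrow> nat" where
  "vertex_time t n = count_time (acost in_part) n + count_time (acost in_block) n
     + for_time 1 t (try_time n) + count_time (acost (Both (has_colour ''x'') in_block)) n + 100"

definition part_time :: "nat \<Rightarrow> nat \<Rightarrow> nat" where
  "part_time t n = for_time 4 (n + 1) (for_time 2 n (vertex_time t n + 100))
     + count_time (acost in_block) n + 100"

definition program_time :: "nat \<Rightarrow> nat \<Rightarrow> nat" where
  "program_time t n = for_time 2 n 100
     + for_time 2 n (count_time (acost (Both adjacent
            (Less (Arr ''part'' (Var ''w'')) (Arr ''part'' (Var ''v''))))) n + 100)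
     + for_time 4 (n + 2) (part_time t n) + 100"

text \<open>For fixed \<open>t\<close> the search through a list takes a constant number of rounds,
  so the bound is a polynomial in \<open>n\<close> alone. The summands 100 leave room for single
  assignments and tests.\<close>

lemma is_poly_program_time: "is_poly (program_time t)"
  unfolding program_time_def [abs_def] part_time_def vertex_time_def try_time_def
  by (intro is_poly_const is_poly_ident is_poly_count_time is_poly_for_time is_poly_add)

section \<open>Correctness of the program on a fixed instance\<close>

locale program_instance = list_instance "{..<n}" E P L k d t
  for n :: nat and E :: "nat set set" and P :: "nat \<Rightarrow> nat" and L :: "nat \<Rightarrow> nat set" and k d t :: nat
begin

text \<open>The data that the main loop only reads: the input together with the tables built from
  it.\<close>

definition prepared :: "state \<Rightarrow> bool" where
  "prepared s \<longleftrightarrow> s ''n'' 0 = n \<and>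
     (\<forall>u<n. \<forall>v<n. s ''adj'' (s ''row'' u + v) = of_bool (v \<in> neighbours E u)) \<and>
     (\<forall>v<n. s ''part'' v = P v) \<and>
     (\<forall>v<n. s ''deg'' v = back_degree {..<n} E P v) \<and>
     (\<forall>v<n. bij_betw (\<lambda>i. s ''list'' (s ''lrow'' v + i)) {..<t} (L v))"

lemma preparedD:
  assumes "prepared s"
  shows "s ''n'' 0 = n"
    "u < n \<Longrightarrow> v < n \<Longrightarrow> s ''adj'' (s ''row'' u + v) = of_bool (v \<in> neighbours E u)"
    "v < n \<Longrightarrow> s ''part'' v = P v"
    "v < n \<Longrightarrow> s ''deg'' v = back_degree {..<n} E P v"
    "v < n \<Longrightarrow> bij_betw (\<lambda>i. s ''list'' (s ''lrow'' v + i)) {..<t} (L v)"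
  using assms unfolding prepared_def by simp_all

lemma prepared_agree:
  assumes "prepared s" "agree X s s'"
    "X \<inter> {''n'', ''adj'', ''row'', ''part'', ''deg'', ''list'', ''lrow''} = {}"
  shows "prepared s'"
proof -
  have "s' y = s y" if "y \<in> {''n'', ''adj'', ''row'', ''part'', ''deg'', ''list'', ''lrow''}" for y
    using assms(2,3) that unfolding agree_def by blast
  then have eqs: "s' ''n'' = s ''n''" "s' ''adj'' = s ''adj''" "s' ''row'' = s ''row''"
    "s' ''part'' = s ''part''" "s' ''deg'' = s ''deg''" "s' ''list'' = s ''list''"
    "s' ''lrow'' = s ''lrow''" by blast+
  show ?thesis using assms(1) unfolding prepared_def eqs .
qed

text \<open>The program has no array for \<open>C\<close>; it recognises coloured vertices by their
  positive block numbers.\<close>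

lemma coloured_part_eq:
  assumes inv: "part_inv j C col blk b"
  shows "coloured_part j C = {m. m < n \<and> P m = j \<and> 0 < blk m}"
proof -
  note base = part_invD(1)[OF inv]
  have "m \<in> C \<longleftrightarrow> 0 < blk m" if "m < n" for m
    using baseD(4,5)[OF base] that
    by (metis DiffI lessThan_iff less_numeral_extra(3) not_one_le_zero zero_less_iff_neq_zero)
  then show ?thesis unfolding coloured_part_def using part_invD(2)[OF inv] by blast
qed

lemma try_colour:
  assumes pr: "prepared s" and inv: "part_inv j C (s ''col'') (s ''blk'') b"
    and v: "s ''v'' 0 = v" "v < n" and q: "s ''q'' 0 = q" "q < t"
    and j: "s ''j'' 0 = j" and b: "s ''b'' 0 = b"
    and i: "s ''i'' 0 = todo j C" and f: "s ''f'' 0 = free (s ''blk'') b"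
    and c: "c = s ''list'' (s ''lrow'' v + q)"
  shows "\<exists>s'. runs (try_colour d) (try_time n) s s' \<and> agree {''c'', ''r'', ''a'', ''w'', ''x''} s s' \<and>
    s' ''x'' 0 = (if admissible j C (s ''col'') (s ''blk'') b v c then c else s ''x'' 0)"
proof -
  let ?col = "s ''col''" and ?blk = "s ''blk''"
  have cL: "c \<in> L v" using preparedD(5)[OF pr v(2)] q(2) c by (auto simp: bij_betw_def)
  define s1 where "s1 = s(''c'' := (s ''c'')(0 := c))"
  have r1: "runs (Set ''c'' (Arr ''list'' (Plus (Arr ''lrow'' (Var ''v'')) (Var ''q'')))) 9 s s1"
    using runs_Set[of "''c''" "Arr ''list'' (Plus (Arr ''lrow'' (Var ''v'')) (Var ''q''))" s] c v q
    by (simp add: s1_def numeral_eq_Suc)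
  have a1: "agree {''c''} s s1" by (simp add: s1_def agree_def)
  have c1: "s1 ''c'' 0 = c" by (simp add: s1_def)
  obtain s2 where r2: "runs (Count ''r'' (Both adjacent (has_colour ''c'')))
        (count_time (acost (Both adjacent (has_colour ''c''))) n) s1 s2"
    and a2: "agree {''r'', ''w''} s1 s2"
    and v2: "s2 ''r'' 0 = card {m. m < n \<and> (m \<in> neighbours E v \<and> ?col m = c)}"
  proof (rule exE[OF runs_Count[of "''r''" s1 n "Both adjacent (has_colour ''c'')"
        "\<lambda>m. m \<in> neighbours E v \<and> ?col m = c"]])
    show "s1 ''n'' 0 = n" using preparedD(1)[OF pr] by (simp add: s1_def)
    fix s' m assume s': "agree {''r'', ''w''} s1 s'" "s' ''w'' 0 = m" "m < n"
    show "aval (Both adjacent (has_colour ''c'')) s' = of_bool (m \<in> neighbours E v \<and> ?col m = c)"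
      using preparedD(2)[OF pr v(2) s'(3)] v s'(2)
      by (simp add: adjacent_def has_colour_def agreeD[OF s'(1)] s1_def)
  qed auto
  have a12: "agree {''c'', ''r'', ''w''} s s2" using a1 a2 by (rule agree_trans) auto
  have c2: "s2 ''c'' 0 = c" using c1 by (simp add: agreeD[OF a2])
  have n2: "s2 ''n'' 0 = n" using preparedD(1)[OF pr] by (simp add: agreeD[OF a12])
  \<comment> \<open>One predicate for both branches, so that the two counts have a common
    postcondition.\<close>
  let ?Q = "\<lambda>m. ?col m = c \<and> (if free ?blk b < todo j C then P m = j \<and> 0 < ?blk m else ?blk m = b)"
  have "\<exists>s3. runs (Cond (Less (Var ''f'') (Var ''i''))
            (Count ''a'' (Both (has_colour ''c'') in_part))
            (Count ''a'' (Both (has_colour ''c'') in_block)))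
        (acost (Less (Var ''f'') (Var ''i'')) + 1 + count_time (acost (Both (has_colour ''c'') in_part)) n
          + count_time (acost (Both (has_colour ''c'') in_block)) n) s2 s3 \<and>
      agree {''a'', ''w''} s2 s3 \<and> s3 ''a'' 0 = card {m. m < n \<and> ?Q m}"
  proof (rule runs_Cond_ex)
    have fi: "aval (Less (Var ''f'') (Var ''i'')) s2 \<noteq> 0 \<longleftrightarrow> free ?blk b < todo j C"
      using i f by (simp add: agreeD[OF a12])
    assume "aval (Less (Var ''f'') (Var ''i'')) s2 \<noteq> 0"
    then have True: "free ?blk b < todo j C" by (simp only: fi)
    show "\<exists>s3. runs (Count ''a'' (Both (has_colour ''c'') in_part))
        (count_time (acost (Both (has_colour ''c'') in_part)) n) s2 s3 \<and>
        agree {''a'', ''w''} s2 s3 \<and> s3 ''a'' 0 = card {m. m < n \<and> ?Q m}"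
    proof (rule runs_Count[where Q = ?Q])
      show "s2 ''n'' 0 = n" by (rule n2)
      fix s' m assume s': "agree {''a'', ''w''} s2 s'" "s' ''w'' 0 = m" "m < n"
      show "aval (Both (has_colour ''c'') in_part) s' = of_bool (?Q m)"
        using preparedD(3)[OF pr s'(3)] s'(2) c2 j True
        by (simp add: in_part_def has_colour_def agreeD[OF s'(1)] agreeD[OF a12])
    qed simp
  next
    have fi: "aval (Less (Var ''f'') (Var ''i'')) s2 = 0 \<longleftrightarrow> \<not> free ?blk b < todo j C"
      using i f by (simp add: agreeD[OF a12])
    assume "aval (Less (Var ''f'') (Var ''i'')) s2 = 0"
    then have False: "\<not> free ?blk b < todo j C" by (simp only: fi simp_thms)
    show "\<exists>s3. runs (Count ''a'' (Both (has_colour ''c'') in_block))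
        (count_time (acost (Both (has_colour ''c'') in_block)) n) s2 s3 \<and>
        agree {''a'', ''w''} s2 s3 \<and> s3 ''a'' 0 = card {m. m < n \<and> ?Q m}"
    proof (rule runs_Count[where Q = ?Q])
      show "s2 ''n'' 0 = n" by (rule n2)
      fix s' m assume s': "agree {''a'', ''w''} s2 s'" "s' ''w'' 0 = m" "m < n"
      show "aval (Both (has_colour ''c'') in_block) s' = of_bool (?Q m)"
        using s'(2) c2 b False
        by (simp add: in_block_def has_colour_def agreeD[OF s'(1)] agreeD[OF a12])
    qed simp
  qed
  then obtain s3 where r3: "runs (Cond (Less (Var ''f'') (Var ''i''))
            (Count ''a'' (Both (has_colour ''c'') in_part))
            (Count ''a'' (Both (has_colour ''c'') in_block)))
        (acost (Less (Var ''f'') (Var ''i'')) + 1 + count_time (acost (Both (has_colour ''c'') in_part)) n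
          + count_time (acost (Both (has_colour ''c'') in_block)) n) s2 s3"
    and a3: "agree {''a'', ''w''} s2 s3" and v3: "s3 ''a'' 0 = card {m. m < n \<and> ?Q m}" by blast
  have a13: "agree {''c'', ''r'', ''a'', ''w''} s s3" using a12 a3 by (rule agree_trans) auto
  have "s3 ''r'' 0 = card (coloured_neighbours ?col v c)"
    using v2 by (simp add: agreeD[OF a3] coloured_neighbours_def)
  moreover have "s3 ''a'' 0 = 0 \<longleftrightarrow> c \<notin> avoided j C ?col ?blk b"
  proof -
    let ?A = "if todo j C \<le> free ?blk b then block ?blk b else coloured_part j C"
    have eq: "{m. m < n \<and> ?Q m} = {m \<in> (if todo j C \<le> free ?blk b then block ?blk b else coloured_part j C). ?col m = c}"
    proof (cases "todo j C \<le> free ?blk b")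
      case True
      then show ?thesis by (auto simp: block_def)
    next
      case False
      with coloured_part_eq[OF inv] show ?thesis by auto
    qed
    have "finite ?A" using part_invD(2)[OF inv] by simp
    then have "finite {m \<in> ?A. ?col m = c}" by (rule rev_finite_subset) blast
    then have "card {m \<in> ?A. ?col m = c} = 0 \<longleftrightarrow> {m \<in> ?A. ?col m = c} = {}"
      by (rule card_0_eq)
    also have "\<dots> \<longleftrightarrow> c \<notin> ?col ` ?A" by blast
    finally show ?thesis unfolding v3 avoided_def eq .
  qed
  ultimately have adm: "s3 ''r'' 0 < d \<and> s3 ''a'' 0 = 0 \<longleftrightarrow> admissible j C ?col ?blk b v c"
    using cL by (auto simp: admissible_def)
  have c3: "s3 ''c'' 0 = c" using c2 by (simp add: agreeD[OF a3])
  define s4 where "s4 = (if admissible j C ?col ?blk b v c then s3(''x'' := (s3 ''x'')(0 := c)) else s3)"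
  have r4: "runs (Cond (Both (Less (Var ''r'') (Num d)) (Equal (Var ''a'') (Num 0)))
            (Set ''x'' (Var ''c'')) Skip)
     (acost (Both (Less (Var ''r'') (Num d)) (Equal (Var ''a'') (Num 0))) + 1 + (acost (Var ''c'') + 2) + 1) s3 s4"
  proof (rule runs_Cond)
    show "runs (Set ''x'' (Var ''c'')) (acost (Var ''c'') + 2) s3 s4"
      if "aval (Both (Less (Var ''r'') (Num d)) (Equal (Var ''a'') (Num 0))) s3 \<noteq> 0"
      using runs_Set[of "''x''" "Var ''c''" s3] that adm c3 by (simp add: s4_def split: if_splits)
    show "runs Skip 1 s3 s4"
      if "aval (Both (Less (Var ''r'') (Num d)) (Equal (Var ''a'') (Num 0))) s3 = 0"
      using runs_Skip[of s3] that adm by (simp add: s4_def split: if_splits)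
  qed
  have "agree {''x''} s3 s4" by (simp add: s4_def agree_def)
  with a13 have a14: "agree {''c'', ''r'', ''a'', ''w'', ''x''} s s4" by (rule agree_trans) auto
  have "runs (try_colour d) (try_time n) s s4"
    unfolding try_colour_def
    by (rule runs_mono[OF runs_Seq[OF r1 runs_Seq[OF r2 runs_Seq[OF r3 r4]]]]) (simp add: try_time_def)
  moreover have "s4 ''x'' 0 = (if admissible j C ?col ?blk b v c then c else s ''x'' 0)"
    by (simp add: s4_def agreeD[OF a13])
  ultimately show ?thesis using a14 by blast
qed

text \<open>The search passes through all of \<open>L v\<close>, which the array \<open>list\<close>
  enumerates, and \<open>admissible_exists\<close> guarantees a hit; \<open>part_inv_step\<close>
  then covers the assignments.\<close>

lemma colour_vertex:
  assumes pr: "prepared s" and inv: "part_inv j C (s ''col'') (s ''blk'') b"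
    and v: "s ''v'' 0 = v" "v < n" "v \<notin> C" "P v = j"
    and max: "\<And>w. w \<in> coloured_part j C \<Longrightarrow>
      back_degree {..<n} E P v \<le> back_degree {..<n} E P w"
    and j: "s ''j'' 0 = j" and b: "s ''b'' 0 = b"
  shows "\<exists>s'. runs (colour_vertex k d t) (vertex_time t n) s s' \<and>
    agree {''w'', ''r'', ''i'', ''f'', ''q'', ''c'', ''a'', ''x'', ''blk'', ''col''} s s' \<and>
    part_inv j (insert v C) (s' ''col'') (s' ''blk'') b"
proof -
  let ?col = "s ''col''" and ?blk = "s ''blk''"
  let ?adm = "admissible j C ?col ?blk b v"
  define lst where "lst i = s ''list'' (s ''lrow'' v + i)" for i
  have n: "s ''n'' 0 = n" using preparedD(1)[OF pr] .
  obtain s1 where r1: "runs (Count ''r'' in_part) (count_time (acost in_part) n) s s1"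
    and a1: "agree {''r'', ''w''} s s1" and v1: "s1 ''r'' 0 = card {m. m < n \<and> (P m = j \<and> 0 < ?blk m)}"
  proof (rule exE[OF runs_Count[of "''r''" s n in_part "\<lambda>m. P m = j \<and> 0 < ?blk m"]])
    fix s' m assume s': "agree {''r'', ''w''} s s'" "s' ''w'' 0 = m" "m < n"
    show "aval in_part s' = of_bool (P m = j \<and> 0 < ?blk m)"
      using preparedD(3)[OF pr s'(3)] s'(2) j by (simp add: in_part_def agreeD[OF s'(1)])
  qed (use n in auto)
  define s2 where "s2 = s1(''i'' := (s1 ''i'')(0 := todo j C))"
  have r2: "runs (Set ''i'' (Minus (Num k) (Var ''r''))) 6 s1 s2"
    using runs_Set[of "''i''" "Minus (Num k) (Var ''r'')" s1] v1 coloured_part_eq[OF inv]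
    by (simp add: s2_def todo_def numeral_eq_Suc)
  have a2: "agree {''r'', ''w'', ''i''} s s2"
    using agree_trans[OF a1 agree_upd[OF agree_refl, of "''i''" "{''i''}"]] by (auto simp: s2_def)
  obtain s3 where r3: "runs (Count ''r'' in_block) (count_time (acost in_block) n) s2 s3"
    and a23: "agree {''r'', ''w''} s2 s3" and v3: "s3 ''r'' 0 = card {m. m < n \<and> ?blk m = b}"
  proof (rule exE[OF runs_Count[of "''r''" s2 n in_block "\<lambda>m. ?blk m = b"]])
    fix s' m assume s': "agree {''r'', ''w''} s2 s'" "s' ''w'' 0 = m" "m < n"
    show "aval in_block s' = of_bool (?blk m = b)"
      using s'(2) b by (simp add: in_block_def agreeD[OF s'(1)] agreeD[OF a2])
  qed (use n in \<open>auto simp: agreeD[OF a2]\<close>)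
  have a3: "agree {''r'', ''w'', ''i''} s s3" using a2 a23 by (rule agree_trans) auto
  have i3: "s3 ''i'' 0 = todo j C" by (simp add: agreeD[OF a23] s2_def)
  define s4 where "s4 = s3(''f'' := (s3 ''f'')(0 := free ?blk b))"
  have r4: "runs (Set ''f'' (Minus (Num t) (Var ''r''))) 6 s3 s4"
    using runs_Set[of "''f''" "Minus (Num t) (Var ''r'')" s3] v3
    by (simp add: s4_def free_def block_def numeral_eq_Suc)
  have a4: "agree {''r'', ''w'', ''i'', ''f''} s s4"
    using agree_trans[OF a3 agree_upd[OF agree_refl, of "''f''" "{''f''}"]] by (auto simp: s4_def)
  have i4: "s4 ''i'' 0 = todo j C" and f4: "s4 ''f'' 0 = free ?blk b"
    using i3 by (simp_all add: s4_def)
  let ?X = "{''q'', ''c'', ''r'', ''a'', ''w'', ''x''}"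
  \<comment> \<open>The claim about \<open>x\<close> is conditional because before the first hit
    \<open>x\<close> may hold a colour left over from another vertex.\<close>
  let ?J = "\<lambda>m s'. agree ?X s4 s' \<and> s' ''q'' 0 = m \<and> ((\<exists>i<m. ?adm (lst i)) \<longrightarrow> ?adm (s' ''x'' 0))"
  have "\<exists>s5. runs (For ''q'' (Num t) (try_colour d)) (for_time (acost (Num t)) t (try_time n)) s4 s5 \<and> ?J t s5"
  proof (rule runs_For[where J = ?J])
    show "?J 0 (s4(''q'' := (s4 ''q'')(0 := 0)))" by (simp add: agree_def)
    show "aval (Num t) s' = t \<and> s' ''q'' 0 = m" if "?J m s'" for m s' using that by simp
    show "\<exists>s''. runs (try_colour d) (try_time n) s' s'' \<and> s'' ''q'' 0 = m \<and>
        ?J (m + 1) (s''(''q'' := (s'' ''q'')(0 := m + 1)))" if J: "?J m s'" and m: "m < t" for m s'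
    proof -
      from J have a': "agree ?X s4 s'" and q': "s' ''q'' 0 = m"
        and x': "(\<exists>i<m. ?adm (lst i)) \<longrightarrow> ?adm (s' ''x'' 0)" by blast+
      have a: "agree {''q'', ''c'', ''r'', ''a'', ''w'', ''x'', ''i'', ''f''} s s'"
        using a4 a' by (rule agree_trans) auto
      have c: "lst m = s' ''list'' (s' ''lrow'' v + m)" by (simp add: lst_def agreeD[OF a])
      have "\<exists>s''. runs (try_colour d) (try_time n) s' s'' \<and> agree {''c'', ''r'', ''a'', ''w'', ''x''} s' s'' \<and>
          s'' ''x'' 0 = (if admissible j C (s' ''col'') (s' ''blk'') b v (lst m) then lst m else s' ''x'' 0)"
      proof (rule try_colour[OF _ _ _ v(2) q' m _ _ _ _ c])
        show "prepared s'" using pr a by (rule prepared_agree) auto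
      qed (use inv v(1) j b i4 f4 in \<open>simp_all add: agreeD[OF a] agreeD[OF a']\<close>)
      then obtain s'' where r: "runs (try_colour d) (try_time n) s' s''"
        and a'': "agree {''c'', ''r'', ''a'', ''w'', ''x''} s' s''"
        and x'': "s'' ''x'' 0 = (if ?adm (lst m) then lst m else s' ''x'' 0)"
        by (auto simp: agreeD[OF a])
      have "agree ?X s4 s''" using a' a'' by (rule agree_trans) auto
      then have "agree ?X s4 (s''(''q'' := (s'' ''q'')(0 := m + 1)))" by (rule agree_upd) simp
      moreover have "(\<exists>i<m + 1. ?adm (lst i)) \<longrightarrow> ?adm (s'' ''x'' 0)"
        using x' x'' by (auto simp: less_Suc_eq)
      moreover have "s'' ''q'' 0 = m" using q' by (simp add: agreeD[OF a''])
      ultimately show ?thesis using r by (intro exI[of _ s'']) simp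
    qed
  qed
  then obtain s5 where r5: "runs (For ''q'' (Num t) (try_colour d)) (for_time 1 t (try_time n)) s4 s5"
    and a45: "agree ?X s4 s5" and adm: "(\<exists>i<t. ?adm (lst i)) \<longrightarrow> ?adm (s5 ''x'' 0)" by auto
  define c where "c = s5 ''x'' 0"
  have a5: "agree {''q'', ''c'', ''r'', ''a'', ''w'', ''x'', ''i'', ''f''} s s5"
    using a4 a45 by (rule agree_trans) auto
  have f5: "s5 ''f'' 0 = free ?blk b" using f4 by (simp add: agreeD[OF a45])
  have vC: "v \<in> {..<n} - C" using v by simp
  obtain c' where c': "?adm c'" using admissible_exists[OF inv vC v(4) max] by blast
  then have "c' \<in> L v" by (simp add: admissible_def)
  then obtain i where "i < t" "c' = lst i"
    using preparedD(5)[OF pr v(2)] unfolding bij_betw_def lst_def by blast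
  then have admc: "?adm c" using adm c' unfolding c_def by blast
  obtain s6 where r6: "runs (Count ''r'' (Both (has_colour ''x'') in_block))
      (count_time (acost (Both (has_colour ''x'') in_block)) n) s5 s6"
    and a56: "agree {''r'', ''w''} s5 s6" and v6: "s6 ''r'' 0 = card {m. m < n \<and> (?col m = c \<and> ?blk m = b)}"
  proof (rule exE[OF runs_Count[of "''r''" s5 n "Both (has_colour ''x'') in_block" "\<lambda>m. ?col m = c \<and> ?blk m = b"]])
    fix s' m assume s': "agree {''r'', ''w''} s5 s'" "s' ''w'' 0 = m" "m < n"
    show "aval (Both (has_colour ''x'') in_block) s' = of_bool (?col m = c \<and> ?blk m = b)"
      using s'(2) b by (simp add: in_block_def has_colour_def agreeD[OF s'(1)] agreeD[OF a5] c_def)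
  qed (use n in \<open>auto simp: agreeD[OF a5]\<close>)
  have a6: "agree {''q'', ''c'', ''r'', ''a'', ''w'', ''x'', ''i'', ''f''} s s6"
    using a5 a56 by (rule agree_trans) auto
  have f6: "s6 ''f'' 0 = free ?blk b" and c6: "s6 ''x'' 0 = c"
    using f5 by (simp_all add: agreeD[OF a56] c_def)
  have "s6 ''r'' 0 = 0 \<longleftrightarrow> c \<notin> ?col ` block ?blk b"
  proof -
    have "finite {m. m < n \<and> (?col m = c \<and> ?blk m = b)}" by simp
    then have "s6 ''r'' 0 = 0 \<longleftrightarrow> {m. m < n \<and> (?col m = c \<and> ?blk m = b)} = {}"
      unfolding v6 by (rule card_0_eq)
    also have "\<dots> \<longleftrightarrow> c \<notin> ?col ` block ?blk b" by (auto simp: block_def)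
    finally show ?thesis .
  qed
  then have nb: "b + (1 - (1 - ((1 - free ?blk b) + s6 ''r'' 0))) = next_block ?col ?blk b c"
    by (auto simp: next_block_def)
  define s7 where "s7 = s6(''blk'' := ?blk(v := next_block ?col ?blk b c))"
  let ?e = "Plus (Var ''b'') (Minus (Num 1) (Minus (Num 1) (Plus (Minus (Num 1) (Var ''f'')) (Var ''r''))))"
  have e: "aval ?e s6 = next_block ?col ?blk b c" using nb f6 b by (simp add: agreeD[OF a6])
  have vv: "aval (Var ''v'') s6 = v" and blk6: "s6 ''blk'' = ?blk"
    using v(1) by (simp_all add: agreeD[OF a6])
  have r7: "runs (Assign ''blk'' (Var ''v'') ?e) (acost (Var ''v'') + acost ?e + 1) s6 s7"
    using runs_Assign[of "''blk''" "Var ''v''" ?e s6] by (simp only: e vv blk6 s7_def)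
  define s8 where "s8 = s7(''col'' := ?col(v := c))"
  have r8: "runs (Assign ''col'' (Var ''v'') (Var ''x'')) (acost (Var ''v'') + acost (Var ''x'') + 1) s7 s8"
    using runs_Assign[of "''col''" "Var ''v''" "Var ''x''" s7] v(1) c6
    by (simp add: s8_def s7_def agreeD[OF a6])
  have "runs (colour_vertex k d t) (vertex_time t n) s s8"
    unfolding colour_vertex_def
    by (rule runs_mono[OF runs_Seq[OF r1 runs_Seq[OF r2 runs_Seq[OF r3 runs_Seq[OF r4
        runs_Seq[OF r5 runs_Seq[OF r6 runs_Seq[OF r7 r8]]]]]]]]) (simp add: vertex_time_def)
  moreover have "agree {''w'', ''r'', ''i'', ''f'', ''q'', ''c'', ''a'', ''x'', ''blk'', ''col''} s s8"
    unfolding s8_def s7_def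
    by (intro agree_upd agree_trans[OF a6 agree_refl]) auto
  moreover have "part_inv j (insert v C) (s8 ''col'') (s8 ''blk'') b"
    using part_inv_step[OF inv vC v(4) max admc] by (simp add: s8_def s7_def)
  ultimately show ?thesis by blast
qed

text \<open>The coloured vertices when round \<open>e\<close> for part \<open>j\<close> is about to
  visit \<open>v\<close>. Round \<open>e\<close> treats the back degree n - e; writing this with
  additions avoids truncation.\<close>

definition progress :: "nat \<Rightarrow> nat \<Rightarrow> nat \<Rightarrow> nat set" where
  "progress j e v = {w. w < n \<and> (P w < j \<or> P w = j \<and>
     (n < back_degree {..<n} E P w + e \<or> back_degree {..<n} E P w + e = n \<and> w < v))}"

definition before :: "nat \<Rightarrow> nat set" where
  "before j = {w. w < n \<and> P w < j}"

text \<open>Back degrees are at most \<open>n\<close>, so nothing of part \<open>j\<close> is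
  coloured before round 0, and all of it is after round \<open>n\<close>.\<close>

lemma progress_simps:
  "progress j 0 0 = before j"
  "progress j e n = progress j (e + 1) 0"
  "progress j (n + 1) 0 = before (j + 1)"
proof -
  have "back_degree {..<n} E P w \<le> n" for w
    unfolding back_degree_def using card_mono[of "{..<n}" "neighbours E w \<inter> {u \<in> {..<n}. P u < P w}"]
    by auto
  then have "\<not> n < back_degree {..<n} E P w" for w by (simp add: not_less)
  then show "progress j 0 0 = before j" by (auto simp: progress_def before_def)
qed (auto simp: progress_def before_def)

lemma visit:
  assumes pr: "prepared s" and inv: "part_inv j (progress j e v) (s ''col'') (s ''blk'') b"
    and v: "s ''v'' 0 = v" "v < n" and j: "s ''j'' 0 = j" and b: "s ''b'' 0 = b" and e: "s ''e'' 0 = e"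
  shows "\<exists>s'. runs (visit k d t) (vertex_time t n + 100) s s' \<and>
    (agree {''w'', ''r'', ''i'', ''f'', ''q'', ''c'', ''a'', ''x'', ''blk'', ''col''} s s' \<and>
    part_inv j (progress j e (v + 1)) (s' ''col'') (s' ''blk'') b)"
proof -
  let ?deg = "back_degree {..<n} E P"
  let ?X = "{''w'', ''r'', ''i'', ''f'', ''q'', ''c'', ''a'', ''x'', ''blk'', ''col''}"
  let ?test = "Both (Equal (Arr ''part'' (Var ''v'')) (Var ''j''))
     (Equal (Plus (Arr ''deg'' (Var ''v'')) (Var ''e'')) (Var ''n''))"
  have test: "aval ?test s = of_bool (P v = j \<and> ?deg v + e = n)"
    using preparedD(1,3,4)[OF pr] v j e by simp
  have "\<exists>s'. runs (visit k d t) (acost ?test + 1 + vertex_time t n + 1) s s' \<and>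
    (agree ?X s s' \<and> part_inv j (progress j e (v + 1)) (s' ''col'') (s' ''blk'') b)"
    unfolding visit_def
  proof (rule runs_Cond_ex)
    assume "aval ?test s \<noteq> 0"
    then have vj: "P v = j" "?deg v + e = n" unfolding test by auto
    have "v \<notin> progress j e v" using vj by (auto simp: progress_def)
    \<comment> \<open>The back degree of \<open>v\<close> is exactly n - e, and only vertices of at
      least this back degree have been coloured in the part.\<close>
    moreover have "?deg v \<le> ?deg w" if "w \<in> coloured_part j (progress j e v)" for w
      using that vj by (auto simp: coloured_part_def progress_def)
    moreover have "insert v (progress j e v) = progress j e (v + 1)"
      using vj v(2) by (auto simp: progress_def less_Suc_eq)
    ultimately show "\<exists>s'. runs (colour_vertex k d t) (vertex_time t n) s s' \<and>
      (agree ?X s s' \<and> part_inv j (progress j e (v + 1)) (s' ''col'') (s' ''blk'') b)"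
      using colour_vertex[OF pr inv v _ vj(1) _ j b] by simp
  next
    assume "aval ?test s = 0"
    then have "\<not> (P v = j \<and> ?deg v + e = n)" unfolding test by auto
    then have "progress j e v = progress j e (v + 1)" by (auto simp: progress_def less_Suc_eq)
    then show "\<exists>s'. runs Skip 1 s s' \<and>
      (agree ?X s s' \<and> part_inv j (progress j e (v + 1)) (s' ''col'') (s' ''blk'') b)"
      using runs_Skip[of s] agree_refl[of ?X s] inv by metis
  qed
  then show ?thesis by (rule ex_forward) (auto elim!: runs_mono)
qed

lemma visit_all:
  assumes pr: "prepared s" and inv: "part_inv j (progress j e 0) (s ''col'') (s ''blk'') b"
    and j: "s ''j'' 0 = j" and b: "s ''b'' 0 = b" and e: "s ''e'' 0 = e"
  shows "\<exists>s'. runs (For ''v'' (Var ''n'') (visit k d t)) (for_time 2 n (vertex_time t n + 100)) s s' \<and>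
    agree {''v'', ''w'', ''r'', ''i'', ''f'', ''q'', ''c'', ''a'', ''x'', ''blk'', ''col''} s s' \<and>
    part_inv j (progress j (e + 1) 0) (s' ''col'') (s' ''blk'') b"
proof -
  let ?X = "{''v'', ''w'', ''r'', ''i'', ''f'', ''q'', ''c'', ''a'', ''x'', ''blk'', ''col''}"
  let ?J = "\<lambda>m s'. agree ?X s s' \<and> s' ''v'' 0 = m \<and> part_inv j (progress j e m) (s' ''col'') (s' ''blk'') b"
  have "\<exists>s'. runs (For ''v'' (Var ''n'') (visit k d t))
      (for_time (acost (Var ''n'')) n (vertex_time t n + 100)) s s' \<and> ?J n s'"
  proof (rule runs_For[where J = ?J])
    show "?J 0 (s(''v'' := (s ''v'')(0 := 0)))" using inv by (simp add: agree_def)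
    show "aval (Var ''n'') s' = n \<and> s' ''v'' 0 = m" if J: "?J m s'" for m s'
    proof -
      have a: "agree ?X s s'" using J by blast
      show ?thesis using J preparedD(1)[OF pr] by (simp add: agreeD[OF a])
    qed
    show "\<exists>s''. runs (visit k d t) (vertex_time t n + 100) s' s'' \<and> s'' ''v'' 0 = m \<and>
        ?J (m + 1) (s''(''v'' := (s'' ''v'')(0 := m + 1)))" if J: "?J m s'" and m: "m < n" for m s'
    proof -
      from J have a: "agree ?X s s'" and v: "s' ''v'' 0 = m"
        and inv': "part_inv j (progress j e m) (s' ''col'') (s' ''blk'') b" by blast+
      have "prepared s'" using pr a by (rule prepared_agree) auto
      then obtain s'' where r: "runs (visit k d t) (vertex_time t n + 100) s' s''"
        and a': "agree {''w'', ''r'', ''i'', ''f'', ''q'', ''c'', ''a'', ''x'', ''blk'', ''col''} s' s''"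
        and i: "part_inv j (progress j e (m + 1)) (s'' ''col'') (s'' ''blk'') b"
        using visit[OF _ inv' v m] j b e by (auto simp: agreeD[OF a])
      have "agree ?X s s''" using a a' by (rule agree_trans) auto
      then have "agree ?X s (s''(''v'' := (s'' ''v'')(0 := m + 1)))" by (rule agree_upd) simp
      moreover have "s'' ''v'' 0 = m" using v by (simp add: agreeD[OF a'])
      ultimately show ?thesis using r i by (intro exI[of _ s'']) simp
    qed
  qed
  then show ?thesis by (auto simp: progress_simps(2))
qed

lemma visit_degrees:
  assumes pr: "prepared s" and inv: "part_inv j (before j) (s ''col'') (s ''blk'') b"
    and j: "s ''j'' 0 = j" and b: "s ''b'' 0 = b"
  shows "\<exists>s'. runs (For ''e'' (Plus (Var ''n'') (Num 1)) (For ''v'' (Var ''n'') (visit k d t)))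
      (for_time 4 (n + 1) (for_time 2 n (vertex_time t n + 100))) s s' \<and>
    agree {''e'', ''v'', ''w'', ''r'', ''i'', ''f'', ''q'', ''c'', ''a'', ''x'', ''blk'', ''col''} s s' \<and>
    part_inv j (before (j + 1)) (s' ''col'') (s' ''blk'') b"
proof -
  let ?X = "{''e'', ''v'', ''w'', ''r'', ''i'', ''f'', ''q'', ''c'', ''a'', ''x'', ''blk'', ''col''}"
  let ?J = "\<lambda>m s'. agree ?X s s' \<and> s' ''e'' 0 = m \<and> part_inv j (progress j m 0) (s' ''col'') (s' ''blk'') b"
  let ?p = "For ''v'' (Var ''n'') (visit k d t)" and ?T = "for_time 2 n (vertex_time t n + 100)"
  have "\<exists>s'. runs (For ''e'' (Plus (Var ''n'') (Num 1)) ?p)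
      (for_time (acost (Plus (Var ''n'') (Num 1))) (n + 1) ?T) s s' \<and> ?J (n + 1) s'"
  proof (rule runs_For[where J = ?J])
    show "?J 0 (s(''e'' := (s ''e'')(0 := 0)))" using inv by (simp add: agree_def progress_simps(1))
    show "aval (Plus (Var ''n'') (Num 1)) s' = n + 1 \<and> s' ''e'' 0 = m" if J: "?J m s'" for m s'
    proof -
      have a: "agree ?X s s'" using J by blast
      show ?thesis using J preparedD(1)[OF pr] by (simp add: agreeD[OF a])
    qed
    show "\<exists>s''. runs ?p ?T s' s'' \<and> s'' ''e'' 0 = m \<and>
        ?J (m + 1) (s''(''e'' := (s'' ''e'')(0 := m + 1)))" if J: "?J m s'" and m: "m < n + 1" for m s'
    proof -
      from J have a: "agree ?X s s'" and e: "s' ''e'' 0 = m"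
        and inv': "part_inv j (progress j m 0) (s' ''col'') (s' ''blk'') b" by blast+
      have "prepared s'" using pr a by (rule prepared_agree) auto
      then obtain s'' where r: "runs ?p ?T s' s''"
        and a': "agree {''v'', ''w'', ''r'', ''i'', ''f'', ''q'', ''c'', ''a'', ''x'', ''blk'', ''col''} s' s''"
        and i: "part_inv j (progress j (m + 1) 0) (s'' ''col'') (s'' ''blk'') b"
        using visit_all[OF _ inv' _ _ e] j b by (auto simp: agreeD[OF a])
      have "agree ?X s s''" using a a' by (rule agree_trans) auto
      then have "agree ?X s (s''(''e'' := (s'' ''e'')(0 := m + 1)))" by (rule agree_upd) simp
      moreover have "s'' ''e'' 0 = m" using e by (simp add: agreeD[OF a'])
      ultimately show ?thesis using r i by (intro exI[of _ s'']) simp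
    qed
  qed
  then show ?thesis unfolding progress_simps(3) by auto
qed

lemma colour_part:
  assumes pr: "prepared s" and inv: "part_inv j (before j) (s ''col'') (s ''blk'') (s ''b'' 0)"
    and j: "s ''j'' 0 = j"
  shows "\<exists>s'. runs (colour_part k d t) (part_time t n) s s' \<and> prepared s' \<and> s' ''j'' 0 = j \<and>
    part_inv (j + 1) (before (j + 1)) (s' ''col'') (s' ''blk'') (s' ''b'' 0)"
proof -
  let ?b = "s ''b'' 0"
  let ?X = "{''e'', ''v'', ''w'', ''r'', ''i'', ''f'', ''q'', ''c'', ''a'', ''x'', ''blk'', ''col''}"
  obtain s1 where r1: "runs (For ''e'' (Plus (Var ''n'') (Num 1)) (For ''v'' (Var ''n'') (visit k d t)))
      (for_time 4 (n + 1) (for_time 2 n (vertex_time t n + 100))) s s1"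
    and a1: "agree ?X s s1" and inv1: "part_inv j (before (j + 1)) (s1 ''col'') (s1 ''blk'') ?b"
    using visit_degrees[OF pr inv j refl] by blast
  have pr1: "prepared s1" using pr a1 by (rule prepared_agree) auto
  let ?col = "s1 ''col''" and ?blk = "s1 ''blk''"
  obtain s2 where r2: "runs (Count ''r'' in_block) (count_time (acost in_block) n) s1 s2"
    and a2: "agree {''r'', ''w''} s1 s2" and v2: "s2 ''r'' 0 = card {m. m < n \<and> ?blk m = ?b}"
  proof (rule exE[OF runs_Count[of "''r''" s1 n in_block "\<lambda>m. ?blk m = ?b"]])
    fix s' m assume s': "agree {''r'', ''w''} s1 s'" "s' ''w'' 0 = m" "m < n"
    show "aval in_block s' = of_bool (?blk m = ?b)"
      using s'(2) by (simp add: in_block_def agreeD[OF s'(1)] agreeD[OF a1])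
  qed (use preparedD(1)[OF pr1] in auto)
  have a12: "agree ?X s s2" using a1 a2 by (rule agree_trans) auto
  let ?b' = "if card (block ?blk ?b) = t then ?b + 1 else ?b"
  \<comment> \<open>\<open>runs_Cond\<close> expects the same final state for both branches; without
    the increment this state is \<open>s2\<close> itself.\<close>
  let ?s3 = "s2(''b'' := (s2 ''b'')(0 := ?b'))"
  have b2: "s2 ''b'' 0 = ?b" by (simp add: agreeD[OF a12])
  have r2': "s2 ''r'' 0 = card (block ?blk ?b)" using v2 by (simp add: block_def)
  let ?C = "Cond (Equal (Var ''r'') (Num t)) (Set ''b'' (Plus (Var ''b'') (Num 1))) Skip"
  have r3: "runs ?C (acost (Equal (Var ''r'') (Num t)) + 1 + 6 + 1) s2 ?s3"
  proof (rule runs_Cond)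
    show "runs (Set ''b'' (Plus (Var ''b'') (Num 1))) 6 s2 ?s3"
      if "aval (Equal (Var ''r'') (Num t)) s2 \<noteq> 0"
      using runs_Set[of "''b''" "Plus (Var ''b'') (Num 1)" s2] that b2 r2'
      by (simp add: numeral_eq_Suc split: if_splits)
    show "runs Skip 1 s2 ?s3" if "aval (Equal (Var ''r'') (Num t)) s2 = 0"
    proof -
      have "(s2 ''b'')(0 := ?b') = s2 ''b''" using that b2 r2' by (auto split: if_splits)
      then have "?s3 = s2" by simp
      then show ?thesis using runs_Skip[of s2] by simp
    qed
  qed
  have "runs (colour_part k d t) (part_time t n) s ?s3"
    unfolding colour_part_def
    by (rule runs_mono[OF runs_Seq[OF r1 runs_Seq[OF r2 r3]]]) (simp add: part_time_def)
  moreover have "prepared ?s3"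
  proof (rule prepared_agree[OF pr])
    show "agree (insert ''b'' ?X) s ?s3"
      by (intro agree_upd agree_trans[OF a12 agree_refl]) auto
  qed auto
  moreover have "?s3 ''j'' 0 = j" using j by (simp add: agreeD[OF a12])
  moreover have "part_inv (j + 1) (before (j + 1)) ?col ?blk ?b'"
    by (rule part_inv_next[OF inv1 _ refl]) (auto simp: coloured_part_def before_def)
  then have "part_inv (j + 1) (before (j + 1)) (?s3 ''col'') (?s3 ''blk'') (?s3 ''b'' 0)"
    by (simp add: agreeD[OF a2])
  ultimately show ?thesis by blast
qed

text \<open>The zero arrays encode that nothing is coloured, which starts the loop with
  \<open>part_inv_init\<close>.\<close>

lemma colour_parts:
  assumes pr: "prepared s" and zero: "s ''col'' = (\<lambda>_. 0)" "s ''blk'' = (\<lambda>_. 0)" and b: "s ''b'' 0 = 1"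
  shows "\<exists>s'. runs (For ''j'' (Plus (Var ''n'') (Num 2)) (colour_part k d t))
      (for_time 4 (n + 2) (part_time t n)) s s' \<and>
    part_inv (n + 2) (before (n + 2)) (s' ''col'') (s' ''blk'') (s' ''b'' 0)"
proof -
  let ?J = "\<lambda>m s'. prepared s' \<and> s' ''j'' 0 = m \<and>
    part_inv m (before m) (s' ''col'') (s' ''blk'') (s' ''b'' 0)"
  have upd: "prepared (s'(''j'' := f))" if "prepared s'" for s' f
    by (rule prepared_agree[OF that, of "{''j''}"]) (auto simp: agree_def)
  have "\<exists>s'. runs (For ''j'' (Plus (Var ''n'') (Num 2)) (colour_part k d t))
      (for_time (acost (Plus (Var ''n'') (Num 2))) (n + 2) (part_time t n)) s s' \<and> ?J (n + 2) s'"
  proof (rule runs_For[where J = ?J])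
    show "?J 0 (s(''j'' := (s ''j'')(0 := 0)))"
      using upd[OF pr] zero b part_inv_init by (simp add: before_def)
    show "aval (Plus (Var ''n'') (Num 2)) s' = n + 2 \<and> s' ''j'' 0 = m" if "?J m s'" for m s'
      using that preparedD(1)[of s'] by simp
    show "\<exists>s''. runs (colour_part k d t) (part_time t n) s' s'' \<and> s'' ''j'' 0 = m \<and>
        ?J (m + 1) (s''(''j'' := (s'' ''j'')(0 := m + 1)))" if "?J m s'" "m < n + 2" for m s'
      using colour_part[of s' m] that upd by auto
  qed
  then show ?thesis by auto
qed

section \<open>Preparation of the tables and the whole program\<close>

lemma rows:
  assumes n: "s ''n'' 0 = n" and zero: "s ''row'' = (\<lambda>_. 0)" "s ''lrow'' = (\<lambda>_. 0)"
  shows "\<exists>s'. runs (For ''v'' (Var ''n'') (prepare_rows t)) (for_time 2 n 100) s s' \<and>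
    agree {''v'', ''row'', ''lrow''} s s' \<and> (\<forall>u\<le>n. s' ''row'' u = n * u \<and> s' ''lrow'' u = t * u)"
proof -
  let ?X = "{''v'', ''row'', ''lrow''}"
  let ?J = "\<lambda>m s'. agree ?X s s' \<and> s' ''v'' 0 = m \<and>
    (\<forall>u\<le>m. s' ''row'' u = n * u \<and> s' ''lrow'' u = t * u)"
  have "\<exists>s'. runs (For ''v'' (Var ''n'') (prepare_rows t)) (for_time (acost (Var ''n'')) n 100) s s' \<and> ?J n s'"
  proof (rule runs_For[where J = ?J])
    show "?J 0 (s(''v'' := (s ''v'')(0 := 0)))" using zero by (simp add: agree_def)
    show "aval (Var ''n'') s' = n \<and> s' ''v'' 0 = m" if J: "?J m s'" for m s'
    proof -
      have a: "agree ?X s s'" using J by blast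
      show ?thesis using J n by (simp add: agreeD[OF a])
    qed
    show "\<exists>s''. runs (prepare_rows t) 100 s' s'' \<and> s'' ''v'' 0 = m \<and>
        ?J (m + 1) (s''(''v'' := (s'' ''v'')(0 := m + 1)))" if J: "?J m s'" for m s'
    proof -
      from J have a: "agree ?X s s'" and v: "s' ''v'' 0 = m"
        and row: "s' ''row'' m = n * m" "s' ''lrow'' m = t * m"
        and rows: "\<forall>u\<le>m. s' ''row'' u = n * u \<and> s' ''lrow'' u = t * u" by blast+
      let ?s1 = "s'(''row'' := (s' ''row'')(m + 1 := n * m + n))"
      let ?s2 = "?s1(''lrow'' := (s' ''lrow'')(m + 1 := t * m + t))"
      have r1: "runs (Assign ''row'' (Plus (Var ''v'') (Num 1)) (Plus (Arr ''row'' (Var ''v'')) (Var ''n''))) 11 s' ?s1"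
        using runs_Assign[of "''row''" "Plus (Var ''v'') (Num 1)" "Plus (Arr ''row'' (Var ''v'')) (Var ''n'')" s']
          v row n by (simp add: agreeD[OF a] numeral_eq_Suc)
      have r2: "runs (Assign ''lrow'' (Plus (Var ''v'') (Num 1)) (Plus (Arr ''lrow'' (Var ''v'')) (Num t))) 10 ?s1 ?s2"
        using runs_Assign[of "''lrow''" "Plus (Var ''v'') (Num 1)" "Plus (Arr ''lrow'' (Var ''v'')) (Num t)" ?s1]
          v row by (simp add: numeral_eq_Suc)
      have "runs (prepare_rows t) 100 s' ?s2"
        unfolding prepare_rows_def by (rule runs_mono[OF runs_Seq[OF r1 r2]]) simp
      moreover have "agree ?X s (?s2(''v'' := (?s2 ''v'')(0 := m + 1)))"
        by (intro agree_upd a) simp_all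
      moreover have "\<forall>u\<le>m + 1. ?s2 ''row'' u = n * u \<and> ?s2 ''lrow'' u = t * u"
        using rows by (auto simp: le_Suc_eq)
      ultimately show ?thesis using v by (intro exI[of _ ?s2]) simp
    qed
  qed
  then show ?thesis by auto
qed

lemma degrees:
  assumes n: "s ''n'' 0 = n"
    and adj: "\<And>u v. u < n \<Longrightarrow> v < n \<Longrightarrow> s ''adj'' (s ''row'' u + v) = of_bool (v \<in> neighbours E u)"
    and part: "\<And>v. v < n \<Longrightarrow> s ''part'' v = P v"
  shows "\<exists>s'. runs (For ''v'' (Var ''n'') prepare_degree)
      (for_time 2 n (count_time (acost (Both adjacent
            (Less (Arr ''part'' (Var ''w'')) (Arr ''part'' (Var ''v''))))) n + 100)) s s' \<and>
    agree {''v'', ''w'', ''r'', ''deg''} s s' \<and> (\<forall>v<n. s' ''deg'' v = back_degree {..<n} E P v)"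
proof -
  let ?X = "{''v'', ''w'', ''r'', ''deg''}"
  let ?e = "Both adjacent (Less (Arr ''part'' (Var ''w'')) (Arr ''part'' (Var ''v'')))"
  let ?T = "count_time (acost ?e) n + 100"
  let ?J = "\<lambda>m s'. agree ?X s s' \<and> s' ''v'' 0 = m \<and> (\<forall>v<m. s' ''deg'' v = back_degree {..<n} E P v)"
  have "\<exists>s'. runs (For ''v'' (Var ''n'') prepare_degree) (for_time (acost (Var ''n'')) n ?T) s s' \<and> ?J n s'"
  proof (rule runs_For[where J = ?J])
    show "?J 0 (s(''v'' := (s ''v'')(0 := 0)))" by (simp add: agree_def)
    show "aval (Var ''n'') s' = n \<and> s' ''v'' 0 = m" if J: "?J m s'" for m s'
    proof -
      have a: "agree ?X s s'" using J by blast
      show ?thesis using J n by (simp add: agreeD[OF a])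
    qed
    show "\<exists>s''. runs prepare_degree ?T s' s'' \<and> s'' ''v'' 0 = v \<and>
        ?J (v + 1) (s''(''v'' := (s'' ''v'')(0 := v + 1)))" if J: "?J v s'" and v: "v < n" for v s'
    proof -
      from J have a: "agree ?X s s'" and v': "s' ''v'' 0 = v"
        and deg: "\<forall>u<v. s' ''deg'' u = back_degree {..<n} E P u" by blast+
      obtain s1 where r1: "runs (Count ''r'' ?e) (count_time (acost ?e) n) s' s1"
        and a1: "agree {''r'', ''w''} s' s1"
        and c1: "s1 ''r'' 0 = card {m. m < n \<and> (m \<in> neighbours E v \<and> P m < P v)}"
      proof (rule exE[OF runs_Count[of "''r''" s' n ?e "\<lambda>m. m \<in> neighbours E v \<and> P m < P v"]])
        fix s'' m assume s'': "agree {''r'', ''w''} s' s''" "s'' ''w'' 0 = m" "m < n"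
        show "aval ?e s'' = of_bool (m \<in> neighbours E v \<and> P m < P v)"
          using adj[OF v s''(3)] part[OF v] part[OF s''(3)] s''(2) v'
          by (simp add: adjacent_def agreeD[OF s''(1)] agreeD[OF a])
      qed (use n in \<open>auto simp: agreeD[OF a]\<close>)
      have "{m. m < n \<and> (m \<in> neighbours E v \<and> P m < P v)} = neighbours E v \<inter> {u \<in> {..<n}. P u < P v}"
        by auto
      with c1 have c1: "s1 ''r'' 0 = back_degree {..<n} E P v" by (simp add: back_degree_def)
      let ?s2 = "s1(''deg'' := (s' ''deg'')(v := back_degree {..<n} E P v))"
      have r2: "runs (Assign ''deg'' (Var ''v'') (Var ''r'')) 5 s1 ?s2"
        using runs_Assign[of "''deg''" "Var ''v''" "Var ''r''" s1] v' c1
        by (simp add: agreeD[OF a1] numeral_eq_Suc)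
      have "runs prepare_degree ?T s' ?s2"
        unfolding prepare_degree_def by (rule runs_mono[OF runs_Seq[OF r1 r2]]) simp
      moreover have "agree ?X s (?s2(''v'' := (?s2 ''v'')(0 := v + 1)))"
        by (intro agree_upd agree_trans[OF a a1]) auto
      moreover have "\<forall>u<v + 1. ?s2 ''deg'' u = back_degree {..<n} E P u"
        using deg by (auto simp: less_Suc_eq)
      moreover have "?s2 ''v'' 0 = v" using v' by (simp add: agreeD[OF a1])
      ultimately show ?thesis by (intro exI[of _ ?s2]) simp
    qed
  qed
  then show ?thesis by auto
qed

lemma colouring_program:
  assumes simple: "\<And>u v. {u, v} \<in> E \<Longrightarrow> u \<noteq> v" and P_le: "\<And>v. v < n \<Longrightarrow> P v \<le> n + 1"
    and part: "s ''part'' = P" and input: "input_state t n E \<eta> S L s"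
  shows "\<exists>s'. runs (colouring_program k d t) (program_time t n) s s' \<and>
    equitable_list_colouring t (d - 1) {..<n} E L (s' ''col'')"
proof -
  from input have n: "s ''n'' 0 = n"
    and adj: "\<And>u v. u < n \<Longrightarrow> v < n \<Longrightarrow> s ''adj'' (n * u + v) = (if {u, v} \<in> E then 1 else 0)"
    and list: "\<And>v. v < n \<Longrightarrow> bij_betw (\<lambda>i. s ''list'' (t * v + i)) {..<t} (L v)"
    and zero: "\<And>x. x \<notin> {''n'', ''adj'', ''part'', ''list''} \<Longrightarrow> s x = (\<lambda>_. 0)"
    by (simp_all add: input_state_def)
  obtain s1 where r1: "runs (For ''v'' (Var ''n'') (prepare_rows t)) (for_time 2 n 100) s s1"
    and a1: "agree {''v'', ''row'', ''lrow''} s s1"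
    and row: "\<And>u. u \<le> n \<Longrightarrow> s1 ''row'' u = n * u" "\<And>u. u \<le> n \<Longrightarrow> s1 ''lrow'' u = t * u"
    using rows[of s] n zero by auto
  \<comment> \<open>Since there are no loops, matrix entries agree with membership in
    \<open>neighbours\<close>, which requires distinct vertices.\<close>
  have nb: "v \<in> neighbours E u \<longleftrightarrow> {u, v} \<in> E" for u v
    using simple[of v u] by (auto simp: neighbours_def insert_commute)
  have adj1: "s1 ''adj'' (s1 ''row'' u + v) = of_bool (v \<in> neighbours E u)" if "u < n" "v < n" for u v
    using adj[OF that] row(1)[of u] that by (simp add: agreeD[OF a1] nb)
  have part1: "s1 ''part'' v = P v" for v using part by (simp add: agreeD[OF a1])
  have list1: "bij_betw (\<lambda>i. s1 ''list'' (s1 ''lrow'' v + i)) {..<t} (L v)" if "v < n" for v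
    using list[OF that] row(2)[of v] that by (simp add: agreeD[OF a1])
  have n1: "s1 ''n'' 0 = n" using n by (simp add: agreeD[OF a1])
  obtain s2 where r2: "runs (For ''v'' (Var ''n'') prepare_degree)
      (for_time 2 n (count_time (acost (Both adjacent
            (Less (Arr ''part'' (Var ''w'')) (Arr ''part'' (Var ''v''))))) n + 100)) s1 s2"
    and a2: "agree {''v'', ''w'', ''r'', ''deg''} s1 s2"
    and deg: "\<And>v. v < n \<Longrightarrow> s2 ''deg'' v = back_degree {..<n} E P v"
    using degrees[of s1] n1 adj1 part1 by blast
  have a12: "agree {''v'', ''row'', ''lrow'', ''w'', ''r'', ''deg''} s s2"
    using a1 a2 by (rule agree_trans) auto
  define s3 where "s3 = s2(''b'' := (s2 ''b'')(0 := 1))"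
  have r3: "runs (Set ''b'' (Num 1)) 3 s2 s3"
    using runs_Set[of "''b''" "Num 1" s2] by (simp add: s3_def numeral_eq_Suc)
  have pr: "prepared s3"
    unfolding prepared_def s3_def using n1 adj1 part1 list1 deg by (simp add: agreeD[OF a2])
  have "\<exists>s'. runs (For ''j'' (Plus (Var ''n'') (Num 2)) (colour_part k d t))
      (for_time 4 (n + 2) (part_time t n)) s3 s' \<and>
    part_inv (n + 2) (before (n + 2)) (s' ''col'') (s' ''blk'') (s' ''b'' 0)"
    by (rule colour_parts[OF pr]) (simp_all add: s3_def agreeD[OF a12] zero)
  then obtain s' where r4: "runs (For ''j'' (Plus (Var ''n'') (Num 2)) (colour_part k d t))
      (for_time 4 (n + 2) (part_time t n)) s3 s'"
    and inv: "part_inv (n + 2) (before (n + 2)) (s' ''col'') (s' ''blk'') (s' ''b'' 0)" by blast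
  \<comment> \<open>Part indices are at most n + 1, so n + 2 rounds starting from 0 reach every
    vertex.\<close>
  have "before (n + 2) = {..<n}" using P_le by (fastforce simp: before_def)
  then have "equitable_list_colouring t (d - 1) {..<n} E L (s' ''col'')"
    using inv P_le by (intro part_inv_complete[of "n + 2" _ "s' ''blk''" "s' ''b'' 0"]) (auto simp: less_Suc_eq_le)
  moreover have "runs (colouring_program k d t) (program_time t n) s s'"
    unfolding colouring_program_def
    by (rule runs_mono[OF runs_Seq[OF r1 runs_Seq[OF r2 runs_Seq[OF r3 r4]]]]) (simp add: program_time_def)
  ultimately show ?thesis by blast
qed

end

section \<open>Uniform polynomial time bound and conclusion\<close>

lemma poly_time_colouring_program:
  assumes "1 \<le> k" "1 \<le> d" "k \<le> t"
  shows "poly_time_equitable_colouring k d t (colouring_program k d t)"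
proof -
  obtain Q :: "nat poly" where Q: "\<And>n. program_time t n = poly Q n"
    using is_poly_program_time[of t] unfolding is_poly_def by blast
  have "\<exists>T s'. exec (colouring_program k d t) s T s' \<and> T \<le> poly Q n \<and>
      equitable_list_colouring t (d - 1) {..<n} E L (s' ''col'')"
    if G: "finite_graph {..<n} E" and part: "kd_partition k d {..<n} E \<eta> S"
      and L: "list_assignment {..<n} L" "uniform_lists t {..<n} L"
      and input: "input_state t n E \<eta> S L s" for n E \<eta> S L s
  proof -
    have P: "v \<in> {..<n} \<Longrightarrow> s ''part'' v \<in> {1..\<eta> + 1} \<and> v \<in> S (s ''part'' v)" for v
      using input by (simp add: input_state_def)
    \<comment> \<open>The part indices stored in the input serve as \<open>P\<close>.\<close>
    interpret list_instance "{..<n}" E "s ''part''" L k d t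
      by (rule list_instance_kd_partition[OF G part _ L assms]) (rule P)
    interpret program_instance n E "s ''part''" L k d t ..
    \<comment> \<open>This keeps the stored indices within the range of the loop over
      \<open>j\<close>.\<close>
    have "\<eta> \<le> n" using kd_partition_length[OF part _ assms(1)] by simp
    then have "s ''part'' v \<le> n + 1" if "v < n" for v using P[of v] that by auto
    moreover have "u \<noteq> v" if "{u, v} \<in> E" for u v
      using G that by (auto simp: finite_graph_def)
    ultimately obtain s' where "runs (colouring_program k d t) (program_time t n) s s'"
      "equitable_list_colouring t (d - 1) {..<n} E L (s' ''col'')"
      using colouring_program[OF _ _ refl input] by blast
    then show ?thesis unfolding runs_def Q by blast
  qed
  then show ?thesis unfolding poly_time_equitable_colouring_def by blast
qed

theorem theorem1:
  fixes k d t :: nat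
  assumes "k \<ge> 1" and "d \<ge> 1" and "t \<ge> 1" and "t \<ge> k"
  shows "(\<forall>(V :: 'a set) E. finite_graph V E \<and> (\<exists>\<eta> S. kd_partition k d V E \<eta> S) \<longrightarrow>
            equitably_choosable t (d - 1) V E) \<and>
         (\<exists>p. poly_time_equitable_colouring k d t p)"
  using equitably_choosable_kd_partition poly_time_colouring_program assms by blast

end
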